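(* Let $c$ be a real positive definite stiffness tensor in dimension $n$ and let $\Sigma\subset\mathbb{C}^n$ (the slowness surface) be the complex vanishing set of the slowness polynomial $P_c$. Then: (1) If $\Sigma$ is smooth as a scheme, then it is smooth as a variety. (2) If $P_c$ is squarefree, then smoothness of $\Sigma$ as a scheme and as a variety are equivalent. If $P_c$ is not squarefree, then $\Sigma$ is not smooth as a scheme. (3) $\Sigma$ is smooth as a complex manifold if and only if it is smooth as a variety.
   Context: A real $n$-dimensional stiffness tensor is an array $c=(c_{ijkl})_{1\le i,j,k,l\le n}$ of reals with $c_{ijkl}=c_{jikl}=c_{klij}$; it is positive definite if $\sum c_{ijkl}A_{ij}A_{kl}>0$ for every nonzero real symmetric $A$. Christoffel matrix: $(\Gamma_c(p))_{il}=\sum_{j,k}c_{ijkl}p_jp_k$, $p\in\mathbb{C}^n$. Slowness polynomial: $P_c(p)=\det(\Gamma_c(p)-\mathrm{Id})$, regarded in $\mathbb{C}[p_1,\dots,p_n]$. For a polynomial $f\in\mathbb{C}[p_1,\dots,p_n]$ with irreducible factorization $f=q_1^{m_1}\cdots q_k^{m_k}$ (distinct irreducibles, up to constants), $\operatorname{rad}(f)=q_1\cdots q_k$; $f$ is squarefree if not divisible by $q^2$ for any non-constant polynomial $q$. The vanishing set of $f$ in $\mathbb{C}^n$ is smooth as a scheme if there are no points of $\mathbb{C}^n$ where $f=0$ and $\nabla f=0$; it is smooth as a variety if the vanishing set of $\operatorname{rad}(f)$ is smooth as a scheme. For $\Sigma$ these notions are applied to $f=P_c$. *)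

theory Defs
  imports
    "HOL-Analysis.Analysis"
    "HOL-Library.Poly_Mapping"
    "HOL-Computational_Algebra.Squarefree"
begin

section \<open>Polynomials in finitely many variables\<close>

text \<open>
  The polynomial ring \<open>\<complex>[p\<^sub>i | i :: 'n]\<close>: finitely supported maps from exponent vectors to
  coefficients, with the convolution product of \<^theory>\<open>HOL-Library.Poly_Mapping\<close>. Its units are
  exactly the nonzero constants, so the library's notions of irreducible and squarefree
  elements, in which "non-constant" reads "non-unit", are the usual ones for polynomials.
\<close>

type_synonym 'n cpoly = "('n \<Rightarrow>\<^sub>0 nat) \<Rightarrow>\<^sub>0 complex"

definition Const :: "complex \<Rightarrow> 'n cpoly" where
  "Const a = Poly_Mapping.single 0 a"

definition Var :: "'n \<Rightarrow> 'n cpoly" where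
  "Var i = Poly_Mapping.single (Poly_Mapping.single i 1) 1"

definition meval :: "'n::finite cpoly \<Rightarrow> complex ^ 'n \<Rightarrow> complex" where
  "meval f x = (\<Sum>m\<in>Poly_Mapping.keys f. Poly_Mapping.lookup f m * (\<Prod>i\<in>UNIV. (x $ i) ^ Poly_Mapping.lookup m i))"

text \<open>
  Formal partial derivative. Subtraction of exponents is truncated, but wherever truncation
  occurs the coefficient is zero.
\<close>

definition mpartial :: "'n \<Rightarrow> 'n cpoly \<Rightarrow> 'n cpoly" where
  "mpartial i f = (\<Sum>m\<in>Poly_Mapping.keys f.
     Poly_Mapping.single (m - Poly_Mapping.single i 1) (of_nat (Poly_Mapping.lookup m i) * Poly_Mapping.lookup f m))"

definition vanishing_set :: "'n::finite cpoly \<Rightarrow> (complex ^ 'n) set" where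
  "vanishing_set f = {x. meval f x = 0}"

lemma meval_superset:
  assumes "finite A" "Poly_Mapping.keys f \<subseteq> A"
  shows "meval f x = (\<Sum>m\<in>A. Poly_Mapping.lookup f m * (\<Prod>i\<in>UNIV. (x $ i) ^ Poly_Mapping.lookup m i))"
  unfolding meval_def using assms by (intro sum.mono_neutral_left) (auto simp: in_keys_iff)

lemma meval_0 [simp]: "meval 0 x = 0"
  by (simp add: meval_def)

lemma meval_add [simp]: "meval (f + g) x = meval f x + meval g x"
proof -
  let ?A = "Poly_Mapping.keys f \<union> Poly_Mapping.keys g"
  have "Poly_Mapping.keys (f + g) \<subseteq> ?A" by (rule keys_add)
  then show ?thesis
    by (simp add: meval_superset[where A = ?A] lookup_add distrib_right sum.distrib)
qed

lemma meval_single [simp]: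
  "meval (Poly_Mapping.single m a) x = a * (\<Prod>i\<in>UNIV. (x $ i) ^ Poly_Mapping.lookup m i)"
  by (simp add: meval_superset[where A = "{m}"])

lemma meval_Const [simp]: "meval (Const a) x = a"
  by (simp add: Const_def)

lemma meval_1 [simp]: "meval 1 x = 1"
  using meval_Const[of 1 x] by (simp add: Const_def)

lemma meval_Var [simp]: "meval (Var i) x = x $ i"
proof -
  have "(\<Prod>j\<in>UNIV. (x $ j) ^ Poly_Mapping.lookup (Poly_Mapping.single i 1) j)
      = (\<Prod>j\<in>UNIV. if j = i then x $ j else 1)"
    by (intro prod.cong) (auto simp: lookup_single when_def)
  then show ?thesis by (simp add: Var_def)
qed

lemma meval_sum [simp]: "meval (sum f A) x = (\<Sum>a\<in>A. meval (f a) x)"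
  by (induction A rule: infinite_finite_induct) auto

lemma cpoly_sum_monomials:
  fixes f :: "'n cpoly"
  shows "f = (\<Sum>m\<in>Poly_Mapping.keys f. Poly_Mapping.single m (Poly_Mapping.lookup f m))"
proof (rule poly_mapping_eqI)
  fix k
  have "(\<Sum>m\<in>Poly_Mapping.keys f. Poly_Mapping.lookup f m when m = k) = Poly_Mapping.lookup f k"
    by (cases "k \<in> Poly_Mapping.keys f") (auto simp: when_def in_keys_iff)
  then show "Poly_Mapping.lookup f k =
      Poly_Mapping.lookup (\<Sum>m\<in>Poly_Mapping.keys f. Poly_Mapping.single m (Poly_Mapping.lookup f m)) k"
    by (simp add: lookup_sum lookup_single)
qed

lemma meval_mult [simp]: "meval (f * g) x = meval f x * meval g x"
proof -
  let ?s = "\<lambda>f m. Poly_Mapping.single m (Poly_Mapping.lookup f m)"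
  have "meval (f * g) x =
      meval ((\<Sum>m\<in>Poly_Mapping.keys f. ?s f m) * (\<Sum>m\<in>Poly_Mapping.keys g. ?s g m)) x"
    using cpoly_sum_monomials[of f] cpoly_sum_monomials[of g] by simp
  also have "\<dots> = meval f x * meval g x"
    by (simp add: sum_product mult_single lookup_add power_add prod.distrib
        meval_def[of f] meval_def[of g] mult_ac)
  finally show ?thesis .
qed

lemma meval_diff [simp]: "meval (f - g) x = meval f x - meval g x"
  using meval_add[of "f - g" g x] by (simp add: eq_diff_eq)

lemma meval_minus [simp]: "meval (- f) x = - meval f x"
  using meval_diff[of 0 f x] by simp

lemma meval_prod [simp]: "meval (prod f A) x = (\<Prod>a\<in>A. meval (f a) x)"
  by (induction A rule: infinite_finite_induct) auto

lemma meval_of_nat [simp]: "meval (of_nat k) x = of_nat k"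
  by (induction k) auto

lemma meval_of_int [simp]: "meval (of_int k) x = of_int k"
  by (cases k rule: int_cases2) auto

lemma meval_det: "meval (det M) x = det (\<chi> i j. meval (M $ i $ j) x)"
  by (simp add: det_def)

lemma meval_mpartial:
  fixes f :: "'n::finite cpoly"
  shows "((\<lambda>z. meval f (\<chi> j. if j = i then z else x $ j)) has_field_derivative meval (mpartial i f) x)
     (at (x $ i))"
proof -
  let ?y = "\<lambda>z. \<chi> j. if j = i then z else x $ j"
  have split: "(\<Prod>j\<in>UNIV. h j) = h i * (\<Prod>j\<in>UNIV - {i}. h j)" for h :: "'n \<Rightarrow> complex"
    by (simp add: prod.remove)
  have mon: "((\<lambda>z. \<Prod>j\<in>UNIV. (?y z $ j) ^ Poly_Mapping.lookup m j) has_field_derivative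
      of_nat (Poly_Mapping.lookup m i) *
      (\<Prod>j\<in>UNIV. (x $ j) ^ Poly_Mapping.lookup (m - Poly_Mapping.single i 1) j)) (at (x $ i))" for m
  proof -
    have 1: "(\<Prod>j\<in>UNIV. (?y z $ j) ^ Poly_Mapping.lookup m j) =
        z ^ Poly_Mapping.lookup m i * (\<Prod>j\<in>UNIV - {i}. (x $ j) ^ Poly_Mapping.lookup m j)" for z
      by (subst split) (auto intro!: prod.cong)
    have 2: "(\<Prod>j\<in>UNIV. (x $ j) ^ Poly_Mapping.lookup (m - Poly_Mapping.single i 1) j) =
        (x $ i) ^ (Poly_Mapping.lookup m i - 1) * (\<Prod>j\<in>UNIV - {i}. (x $ j) ^ Poly_Mapping.lookup m j)"
      by (subst split) (auto intro!: prod.cong simp: lookup_minus lookup_single)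
    show ?thesis unfolding 1 2 by (auto intro!: derivative_eq_intros)
  qed
  have "((\<lambda>z. \<Sum>m\<in>Poly_Mapping.keys f. Poly_Mapping.lookup f m * (\<Prod>j\<in>UNIV. (?y z $ j) ^ Poly_Mapping.lookup m j))
      has_field_derivative
      (\<Sum>m\<in>Poly_Mapping.keys f. Poly_Mapping.lookup f m * (of_nat (Poly_Mapping.lookup m i) *
      (\<Prod>j\<in>UNIV. (x $ j) ^ Poly_Mapping.lookup (m - Poly_Mapping.single i 1) j)))) (at (x $ i))"
    by (intro DERIV_sum DERIV_cmult mon)
  then show ?thesis
    by (simp add: meval_def[of f] mpartial_def mult_ac)
qed

text \<open>
  A radical \<open>r\<close> of \<open>f\<close>: the product of the irreducible factors of \<open>f\<close>, pairwise distinct up to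
  constants, each taken once. Every nonzero \<open>f\<close> has one, unique up to a nonzero constant factor.
\<close>

definition is_rad :: "'n cpoly \<Rightarrow> 'n cpoly \<Rightarrow> bool" where
  "is_rad f r \<longleftrightarrow> (\<exists>Q m a. finite Q \<and> (\<forall>q\<in>Q. irreducible q \<and> m q > (0::nat)) \<and>
     (\<forall>q\<in>Q. \<forall>q'\<in>Q. \<forall>b. q' = Const b * q \<longrightarrow> q' = q) \<and>
     a \<noteq> 0 \<and> f = Const a * (\<Prod>q\<in>Q. q ^ m q) \<and> r = \<Prod>Q)"

definition rad :: "'n cpoly \<Rightarrow> 'n cpoly" where
  "rad f = (SOME r. is_rad f r)"

section \<open>Smoothness\<close>

definition smooth_as_scheme :: "'n::finite cpoly \<Rightarrow> bool" where
  "smooth_as_scheme f \<longleftrightarrow> (\<nexists>x. meval f x = 0 \<and> (\<forall>i. meval (mpartial i f) x = 0))"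

definition smooth_as_variety :: "'n::finite cpoly \<Rightarrow> bool" where
  "smooth_as_variety f \<longleftrightarrow> smooth_as_scheme (rad f)"

text \<open>
  Holomorphic maps between open subsets of \<open>\<complex>\<^sup>n\<close>: the real derivative exists and is
  complex linear (\<open>(*s)\<close> is multiplication by a complex scalar).
\<close>

definition holomorphic_map_on :: "(complex ^ 'n \<Rightarrow> complex ^ 'm) \<Rightarrow> (complex ^ 'n) set \<Rightarrow> bool" where
  "holomorphic_map_on \<phi> U \<longleftrightarrow>
     (\<forall>z\<in>U. \<exists>D. (\<phi> has_derivative D) (at z) \<and> (\<forall>a v. D (a *s v) = a *s D v))"

text \<open>
  A set is smooth as a complex manifold if it is an (embedded) complex submanifold of \<open>\<complex>\<^sup>n\<close>, of
  some dimension \<open>d\<close>: near each of its points, a biholomorphic change of coordinates \<open>\<phi>\<close> flattens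
  it to the coordinate subspace spanned by the \<open>d\<close> coordinates in \<open>I\<close>.
\<close>

definition complex_submanifold :: "nat \<Rightarrow> (complex ^ 'n) set \<Rightarrow> bool" where
  "complex_submanifold d S \<longleftrightarrow> (\<forall>x\<in>S. \<exists>U V (\<phi> :: complex ^ 'n \<Rightarrow> complex ^ 'n) \<psi> I.
     open U \<and> x \<in> U \<and> open V \<and> homeomorphism U V \<phi> \<psi> \<and>
     holomorphic_map_on \<phi> U \<and> holomorphic_map_on \<psi> V \<and>
     card I = d \<and> \<phi> ` (S \<inter> U) = {z \<in> V. \<forall>i. i \<notin> I \<longrightarrow> z $ i = 0})"

definition smooth_as_complex_manifold :: "(complex ^ 'n::finite) set \<Rightarrow> bool" where
  "smooth_as_complex_manifold S \<longleftrightarrow> (\<exists>d. complex_submanifold d S)"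

section \<open>Stiffness tensors and slowness polynomials\<close>

definition stiffness_tensor :: "('n::finite \<Rightarrow> 'n \<Rightarrow> 'n \<Rightarrow> 'n \<Rightarrow> real) \<Rightarrow> bool" where
  "stiffness_tensor c \<longleftrightarrow> (\<forall>i j k l. c i j k l = c j i k l \<and> c i j k l = c k l i j)"

definition positive_definite_tensor :: "('n::finite \<Rightarrow> 'n \<Rightarrow> 'n \<Rightarrow> 'n \<Rightarrow> real) \<Rightarrow> bool" where
  "positive_definite_tensor c \<longleftrightarrow> (\<forall>A :: real ^ 'n ^ 'n. transpose A = A \<longrightarrow> A \<noteq> 0 \<longrightarrow>
     (\<Sum>i\<in>UNIV. \<Sum>j\<in>UNIV. \<Sum>k\<in>UNIV. \<Sum>l\<in>UNIV. c i j k l * A $ i $ j * A $ k $ l) > 0)"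

definition christoffel :: "('n::finite \<Rightarrow> 'n \<Rightarrow> 'n \<Rightarrow> 'n \<Rightarrow> real) \<Rightarrow> complex ^ 'n \<Rightarrow> complex ^ 'n ^ 'n" where
  "christoffel c p = (\<chi> i l. \<Sum>j\<in>UNIV. \<Sum>k\<in>UNIV. of_real (c i j k l) * p $ j * p $ k)"

definition christoffel_poly :: "('n::finite \<Rightarrow> 'n \<Rightarrow> 'n \<Rightarrow> 'n \<Rightarrow> real) \<Rightarrow> 'n cpoly ^ 'n ^ 'n" where
  "christoffel_poly c = (\<chi> i l. \<Sum>j\<in>UNIV. \<Sum>k\<in>UNIV. Const (of_real (c i j k l)) * Var j * Var k)"

definition slowness_poly :: "('n::finite \<Rightarrow> 'n \<Rightarrow> 'n \<Rightarrow> 'n \<Rightarrow> real) \<Rightarrow> 'n cpoly" where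
  "slowness_poly c = det (christoffel_poly c - mat 1)"

definition slowness_surface :: "('n::finite \<Rightarrow> 'n \<Rightarrow> 'n \<Rightarrow> 'n \<Rightarrow> real) \<Rightarrow> (complex ^ 'n) set" where
  "slowness_surface c = vanishing_set (slowness_poly c)"

lemma meval_slowness_poly: "meval (slowness_poly c) p = det (christoffel c p - mat 1)"
  unfolding slowness_poly_def meval_det
  by (rule arg_cong[where f = det])
     (simp add: vec_eq_iff christoffel_poly_def christoffel_def mat_def)

end

theory Submission
  imports Defs "HOL-Complex_Analysis.Complex_Analysis" "HOL-Computational_Algebra.Fundamental_Theorem_Algebra"
begin

no_notation fps_nth (infixl "$" 75)

text \<open>
  \<open>P\<^sub>c\<close> is nonzero because \<open>P\<^sub>c(0) = \<plusminus>1\<close>; let \<open>r\<close> be its radical. The main difficulty is the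
  implication from manifold to variety in (3).
  Suppose \<open>{r = 0}\<close> is a submanifold near \<open>x\<close> but \<open>r\<close> and its gradient vanish at \<open>x\<close>. A component
  \<open>h\<close> of a flattening chart vanishes on \<open>{r = 0}\<close> and has \<open>\<partial>\<^sub>i h(x) \<noteq> 0\<close> for some coordinate \<open>i\<close>, so each
  line in direction \<open>i\<close> near \<open>x\<close> meets \<open>{r = 0}\<close> at most once near \<open>x\<close>. By Hurwitz, this intersection
  point is a multiple zero along the line, so \<open>\<partial>\<^sub>i r\<close> vanishes on \<open>{r = 0}\<close> near \<open>x\<close>. On the other hand
  an irreducible factor \<open>q\<close> of \<open>r\<close> with \<open>q(x) = 0\<close> does not divide \<open>\<partial>\<^sub>i r\<close>, so the ideal \<open>(q, \<partial>\<^sub>i r)\<close>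
  contains a nonzero polynomial free of \<open>x\<^sub>i\<close>. As every line in direction \<open>i\<close> close to \<open>x\<close> contains
  a zero of \<open>q\<close>, that polynomial vanishes near \<open>x\<close>, which is absurd.
\<close>

subsection \<open>Polynomials as univariate polynomials in one variable\<close>

text \<open>\<open>f\<close> as a polynomial in \<open>x\<^sub>v\<close> whose coefficients are free of \<open>x\<^sub>v\<close>.\<close>

definition up :: "'n \<Rightarrow> 'n cpoly \<Rightarrow> 'n cpoly poly" where
  "up v f = (\<Sum>m\<in>Poly_Mapping.keys f.
     monom (Poly_Mapping.single (m - Poly_Mapping.single v (Poly_Mapping.lookup m v)) (Poly_Mapping.lookup f m))
       (Poly_Mapping.lookup m v))"

text \<open>Subtracting the full \<open>v\<close>-exponent never truncates, so removing the power of
  \<open>v\<close> is reversible. This collapses the sum in \<open>up\<close> to a single term when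
  coefficients are read off.\<close>

lemma minus_single_eq_iff:
  fixes a m :: "'n \<Rightarrow>\<^sub>0 nat"
  shows "Poly_Mapping.lookup a v = k \<and> a - Poly_Mapping.single v k = m \<longleftrightarrow>
    Poly_Mapping.lookup m v = 0 \<and> a = m + Poly_Mapping.single v k"
  by (auto simp: poly_mapping_eq_iff fun_eq_iff lookup_add lookup_minus lookup_single when_def)

lemma lookup_coeff_up:
  "Poly_Mapping.lookup (coeff (up v f) k) m =
    (if Poly_Mapping.lookup m v = 0 then Poly_Mapping.lookup f (m + Poly_Mapping.single v k) else 0)"
proof -
  have "Poly_Mapping.lookup (coeff (up v f) k) m =
    (\<Sum>a\<in>Poly_Mapping.keys f. if Poly_Mapping.lookup a v = k \<and> a - Poly_Mapping.single v k = m
       then Poly_Mapping.lookup f a else 0)"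
    by (auto simp: up_def coeff_sum lookup_sum lookup_single when_def intro!: sum.cong)
  also have "\<dots> = (if Poly_Mapping.lookup m v = 0 then
      (\<Sum>a\<in>Poly_Mapping.keys f. if a = m + Poly_Mapping.single v k then Poly_Mapping.lookup f a else 0) else 0)"
    unfolding minus_single_eq_iff by auto
  finally show ?thesis by (auto simp: in_keys_iff)
qed

lemma lookup_eq_coeff_up:
  "Poly_Mapping.lookup f m = Poly_Mapping.lookup (coeff (up v f) (Poly_Mapping.lookup m v))
     (m - Poly_Mapping.single v (Poly_Mapping.lookup m v))"
proof -
  have "m - Poly_Mapping.single v (Poly_Mapping.lookup m v) + Poly_Mapping.single v (Poly_Mapping.lookup m v) = m"
    using minus_single_eq_iff[of m v "Poly_Mapping.lookup m v"] by metis
  then show ?thesis by (simp add: lookup_coeff_up lookup_minus)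
qed

lemma up_eqI: "(\<And>k m. Poly_Mapping.lookup m v = 0 \<Longrightarrow>
    Poly_Mapping.lookup f (m + Poly_Mapping.single v k) = Poly_Mapping.lookup (coeff p k) m) \<Longrightarrow>
  (\<And>k m. Poly_Mapping.lookup m v \<noteq> 0 \<Longrightarrow> Poly_Mapping.lookup (coeff p k) m = 0) \<Longrightarrow> up v f = p"
  by (intro poly_eqI poly_mapping_eqI) (simp add: lookup_coeff_up)

lemma up_0 [simp]: "up v 0 = 0"
  by (simp add: up_def)

lemma up_add: "up v (f + g) = up v f + up v g"
  by (rule up_eqI) (auto simp: lookup_coeff_up lookup_add)

lemma up_sum: "up v (sum f S) = (\<Sum>x\<in>S. up v (f x))"
  by (induction S rule: infinite_finite_induct) (auto simp: up_add)

lemma up_diff: "up v (f - g) = up v f - up v g"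
  using up_add[of v "f - g" g] by (simp add: eq_diff_eq)

lemma up_single: "up v (Poly_Mapping.single m a) =
  monom (Poly_Mapping.single (m - Poly_Mapping.single v (Poly_Mapping.lookup m v)) a) (Poly_Mapping.lookup m v)"
  by (cases "a = 0") (auto simp: up_def)

text \<open>By bilinearity it suffices to treat monomials. There the \<open>v\<close>-exponents add,
  and removing each in full is compatible with adding the remaining exponents.\<close>

lemma up_mult: "up v (f * g) = up v f * up v g"
proof -
  let ?s = "\<lambda>f m. Poly_Mapping.single m (Poly_Mapping.lookup f m)"
  have mon: "up v (Poly_Mapping.single m a * Poly_Mapping.single n b) =
      up v (Poly_Mapping.single m a) * up v (Poly_Mapping.single n b)" for m n :: "'a \<Rightarrow>\<^sub>0 nat" and a b
  proof -
    have "m + n - Poly_Mapping.single v (Poly_Mapping.lookup m v + Poly_Mapping.lookup n v) =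
      (m - Poly_Mapping.single v (Poly_Mapping.lookup m v)) + (n - Poly_Mapping.single v (Poly_Mapping.lookup n v))"
      by (rule poly_mapping_eqI) (auto simp: lookup_add lookup_minus lookup_single when_def)
    then show ?thesis by (simp add: mult_single up_single mult_monom lookup_add)
  qed
  have "up v (f * g) = up v ((\<Sum>m\<in>Poly_Mapping.keys f. ?s f m) * (\<Sum>m\<in>Poly_Mapping.keys g. ?s g m))"
    using cpoly_sum_monomials[of f] cpoly_sum_monomials[of g] by simp
  also have "\<dots> = up v (\<Sum>m\<in>Poly_Mapping.keys f. ?s f m) * up v (\<Sum>m\<in>Poly_Mapping.keys g. ?s g m)"
    by (simp add: sum_product up_sum mon)
  finally show ?thesis
    using cpoly_sum_monomials[of f] cpoly_sum_monomials[of g] by simp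
qed

lemma up_eq_iff [simp]: "up v f = up v g \<longleftrightarrow> f = g"
  by (metis lookup_eq_coeff_up poly_mapping_eqI)

lemma up_eq_0_iff [simp]: "up v f = 0 \<longleftrightarrow> f = 0"
  using up_eq_iff[of v f 0] by simp

lemma up_Const [simp]: "up v (Const a) = [:Const a:]"
  by (simp add: Const_def up_single monom_0)

lemma up_Var_power_mult: "up v (Var v ^ k * f) = monom 1 k * up v f"
proof -
  have "up v (Var v) = monom 1 1"
    by (simp add: Var_def up_single)
  then have "up v (Var v ^ k) = monom 1 k" for k
    by (induction k) (use up_Const[of v 1] in \<open>simp_all add: up_mult mult_monom Const_def monom_0 one_pCons\<close>)
  then show ?thesis by (simp add: up_mult)
qed

section \<open>Subrings of polynomials in a given set of variables\<close>

definition polys_in :: "'n set \<Rightarrow> 'n cpoly set" where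
  "polys_in V = {f. \<forall>m\<in>Poly_Mapping.keys f. \<forall>u. u \<notin> V \<longrightarrow> Poly_Mapping.lookup m u = 0}"

lemma polys_in_UNIV [simp]: "polys_in UNIV = UNIV"
  by (simp add: polys_in_def)

lemma lookup_polys_in:
  "f \<in> polys_in V \<Longrightarrow> u \<notin> V \<Longrightarrow> Poly_Mapping.lookup m u \<noteq> 0 \<Longrightarrow> Poly_Mapping.lookup f m = 0"
  by (rule ccontr) (auto simp: polys_in_def simp flip: in_keys_iff)

lemma polys_in_mono: "V \<subseteq> W \<Longrightarrow> polys_in V \<subseteq> polys_in W"
  by (auto simp: polys_in_def)

lemma degree_up_eq_0_iff: "degree (up v f) = 0 \<longleftrightarrow> (\<forall>m\<in>Poly_Mapping.keys f. Poly_Mapping.lookup m v = 0)"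
proof
  assume "degree (up v f) = 0"
  then show "\<forall>m\<in>Poly_Mapping.keys f. Poly_Mapping.lookup m v = 0"
    by (metis coeff_eq_0 in_keys_iff lookup_eq_coeff_up lookup_zero neq0_conv)
next
  assume *: "\<forall>m\<in>Poly_Mapping.keys f. Poly_Mapping.lookup m v = 0"
  have "coeff (up v f) k = 0" if "k > 0" for k
  proof (rule poly_mapping_eqI)
    fix m
    show "Poly_Mapping.lookup (coeff (up v f) k) m = Poly_Mapping.lookup 0 m"
      using bspec[OF *, of "m + Poly_Mapping.single v k"] that
      by (auto simp: lookup_coeff_up lookup_add in_keys_iff)
  qed
  then show "degree (up v f) = 0"
    by (metis degree_le le_zero_eq not_gr_zero)
qed

text \<open>With membership expressed by degrees, closure under the ring operations follows from
  degree bounds, and closure under divisors from additivity of degrees.\<close>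

lemma polys_in_iff: "f \<in> polys_in V \<longleftrightarrow> (\<forall>u. u \<notin> V \<longrightarrow> degree (up u f) = 0)"
  by (auto simp: polys_in_def degree_up_eq_0_iff)

lemma up_polys_in: "f \<in> polys_in V \<Longrightarrow> v \<notin> V \<Longrightarrow> up v f = [:f:]"
proof -
  assume f: "f \<in> polys_in V" and v: "v \<notin> V"
  have "Poly_Mapping.lookup f m = 0" if "Poly_Mapping.lookup m v \<noteq> 0" for m
    using lookup_polys_in[OF f v that] .
  then show "up v f = [:f:]"
    by (intro up_eqI) (auto simp: coeff_pCons lookup_add split: nat.splits)
qed

lemma polys_in_0 [simp]: "0 \<in> polys_in V" and polys_in_Const [simp]: "Const a \<in> polys_in V"
  by (auto simp: polys_in_iff)

lemma polys_in_1 [simp]: "1 \<in> polys_in V"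
  using polys_in_Const[of 1 V] by (simp add: Const_def)

lemma polys_in_add [intro]: "f \<in> polys_in V \<Longrightarrow> g \<in> polys_in V \<Longrightarrow> f + g \<in> polys_in V"
  unfolding polys_in_iff up_add by (metis degree_add_le le_zero_eq)

lemma polys_in_diff [intro]: "f \<in> polys_in V \<Longrightarrow> g \<in> polys_in V \<Longrightarrow> f - g \<in> polys_in V"
  unfolding polys_in_iff up_diff by (metis degree_diff_le le_zero_eq)

lemma polys_in_mult [intro]: "f \<in> polys_in V \<Longrightarrow> g \<in> polys_in V \<Longrightarrow> f * g \<in> polys_in V"
  unfolding polys_in_iff up_mult by (metis degree_mult_le le_zero_eq add_0)

lemma polys_in_power [intro]: "f \<in> polys_in V \<Longrightarrow> f ^ k \<in> polys_in V"
  by (induction k) auto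

lemma polys_in_Var [simp]: "v \<in> V \<Longrightarrow> Var v \<in> polys_in V"
  by (auto simp: polys_in_def Var_def lookup_single when_def)

lemma polys_in_coeff_up:
  assumes f: "f \<in> polys_in (insert v V)"
  shows "coeff (up v f) k \<in> polys_in V"
  unfolding polys_in_def
proof (clarify)
  fix m u assume "m \<in> Poly_Mapping.keys (coeff (up v f) k)" and u: "u \<notin> V"
  then have m: "Poly_Mapping.lookup m v = 0" "Poly_Mapping.lookup f (m + Poly_Mapping.single v k) \<noteq> 0"
    by (auto simp: in_keys_iff lookup_coeff_up split: if_splits)
  show "Poly_Mapping.lookup m u = 0"
  proof (cases "u = v")
    case False
    then show ?thesis
      using m(2) lookup_polys_in[OF f, of u "m + Poly_Mapping.single v k"] u
      by (cases "Poly_Mapping.lookup m u = 0") (auto simp: lookup_add)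
  qed (use m in simp)
qed

lemma polys_in_eq_Const:
  assumes "f \<in> polys_in {}"
  shows "f = Const (Poly_Mapping.lookup f 0)"
proof (rule poly_mapping_eqI)
  fix m
  show "Poly_Mapping.lookup f m = Poly_Mapping.lookup (Const (Poly_Mapping.lookup f 0)) m"
  proof (cases "m = 0")
    case False
    then obtain u where "Poly_Mapping.lookup m u \<noteq> 0"
      by (metis lookup_zero poly_mapping_eqI)
    with assms have "Poly_Mapping.lookup f m = 0"
      by (rule_tac lookup_polys_in) auto
    with False show ?thesis by (simp add: Const_def lookup_single when_def)
  qed (simp add: Const_def)
qed

text \<open>Checked after applying the injective map \<open>up v\<close>: the coefficients are free
  of \<open>v\<close> and become scalars, so the image is the expansion of \<open>up v f\<close>
  into monomials.\<close>

lemma poly_up_Var: "poly (up v f) (Var v) = f"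
proof -
  have "up v (poly (up v f) (Var v)) = (\<Sum>i\<le>degree (up v f). up v (Var v ^ i * coeff (up v f) i))"
    by (simp add: poly_altdef up_sum mult.commute)
  also have "\<dots> = (\<Sum>i\<le>degree (up v f). monom (coeff (up v f) i) i)"
  proof (rule sum.cong)
    fix i
    have "coeff (up v f) i \<in> polys_in (UNIV - {v})"
      by (rule polys_in_coeff_up) (simp add: insert_UNIV)
    then show "up v (Var v ^ i * coeff (up v f) i) = monom (coeff (up v f) i) i"
      by (simp add: up_Var_power_mult up_polys_in smult_monom)
  qed auto
  also have "\<dots> = up v f"
    by (rule poly_as_sum_of_monoms)
  finally show ?thesis by simp
qed

section \<open>Evaluation and identity theorems\<close>

lemma meval_power [simp]: "meval (f ^ k) x = meval f x ^ k"
  by (induction k) auto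

lemma meval_polys_in:
  assumes "f \<in> polys_in V" "\<And>i. i \<in> V \<Longrightarrow> x $ i = y $ i"
  shows "meval f x = meval f y"
proof -
  have "(\<Prod>i\<in>UNIV. (x $ i) ^ Poly_Mapping.lookup m i) = (\<Prod>i\<in>UNIV. (y $ i) ^ Poly_Mapping.lookup m i)"
    if "m \<in> Poly_Mapping.keys f" for m
  proof (rule prod.cong)
    fix i
    show "(x $ i) ^ Poly_Mapping.lookup m i = (y $ i) ^ Poly_Mapping.lookup m i"
      using assms that by (cases "i \<in> V") (auto simp: polys_in_def)
  qed simp
  then show ?thesis by (simp add: meval_def)
qed

text \<open>The coefficients of \<open>up v f\<close> are free of \<open>v\<close>, so they do not
  notice the change of coordinate \<open>v\<close>.\<close>

lemma meval_up:
  "meval f (\<chi> j. if j = v then t else x $ j) = poly (map_poly (\<lambda>c. meval c x) (up v f)) t"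
proof -
  let ?y = "\<chi> j. if j = v then t else x $ j"
  have c: "meval (coeff (up v f) k) ?y = meval (coeff (up v f) k) x" for k
    by (rule meval_polys_in[of _ "UNIV - {v}"])
      (auto intro: polys_in_coeff_up simp: insert_UNIV)
  have "meval f ?y = meval (poly (up v f) (Var v)) ?y"
    by (simp add: poly_up_Var)
  also have "\<dots> = (\<Sum>i\<le>degree (up v f). meval (coeff (up v f) i) x * t ^ i)"
    by (simp add: poly_altdef c)
  also have "\<dots> = poly (map_poly (\<lambda>c. meval c x) (up v f)) t"
  proof -
    let ?p = "map_poly (\<lambda>c. meval c x) (up v f)"
    \<comment> \<open>Evaluating the coefficients at \<open>x\<close> may lower the degree; the
      surplus terms are zero.\<close>
    have "(\<Sum>i\<le>degree (up v f). coeff ?p i * t ^ i) = (\<Sum>i\<le>degree ?p. coeff ?p i * t ^ i)"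
      by (intro sum.mono_neutral_right) (auto simp: map_poly_degree_leq coeff_eq_0)
    then show ?thesis by (simp add: poly_altdef coeff_map_poly)
  qed
  finally show ?thesis .
qed

text \<open>Induction on the set of variables: on each line in direction \<open>v\<close> the
  polynomial vanishes identically, so its coefficients, which involve fewer variables, vanish at
  every point.\<close>

lemma meval_eq_0:
  fixes f :: "'n::finite cpoly"
  assumes "\<And>x. meval f x = 0"
  shows "f = 0"
proof -
  have "f = 0" if "finite V" "f \<in> polys_in V" "\<And>x. meval f x = 0" for V and f :: "'n cpoly"
    using that
  proof (induction V arbitrary: f)
    case empty
    then show ?case using polys_in_eq_Const[of f] meval_Const
      by (metis single_zero Const_def)
  next
    case (insert v V)
    have "coeff (up v f) k = 0" for k
    proof (rule insert.IH)
      show "coeff (up v f) k \<in> polys_in V" using insert.prems by (intro polys_in_coeff_up)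
      fix x
      have "poly (map_poly (\<lambda>c. meval c x) (up v f)) t = 0" for t
        using insert.prems(2) by (simp flip: meval_up)
      then have "map_poly (\<lambda>c. meval c x) (up v f) = 0"
        using poly_all_0_iff_0 by blast
      then have "coeff (map_poly (\<lambda>c. meval c x) (up v f)) k = 0" by simp
      then show "meval (coeff (up v f) k) x = 0" by (simp add: coeff_map_poly)
    qed
    then have "up v f = 0" by (simp add: poly_eq_iff)
    then show ?case by simp
  qed
  from this[of UNIV f] assms show ?thesis by simp
qed

lemma cpoly_eqI: "(\<And>x. meval f x = meval g x) \<Longrightarrow> f = g"
  using meval_eq_0[of "f - g"] by simp

lemma meval_line_poly:
  obtains p where "\<And>t. poly p t = meval f (a + t *s b)"
proof
  show "poly (\<Sum>m\<in>Poly_Mapping.keys f. [:Poly_Mapping.lookup f m:] *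
    (\<Prod>i\<in>UNIV. [:a $ i, b $ i:] ^ Poly_Mapping.lookup m i)) t = meval f (a + t *s b)" for t
    by (simp add: poly_sum poly_prod meval_def algebra_simps)
qed

text \<open>On the line from \<open>x\<close> to a point where \<open>f\<close> is nonzero,
  \<open>f\<close> is a nonzero univariate polynomial with finitely many roots, yet every small
  parameter would be a root.\<close>

lemma meval_open_eq_0:
  assumes "open U" "x \<in> U" "\<And>y. y \<in> U \<Longrightarrow> meval f y = 0"
  shows "f = 0"
proof (rule ccontr)
  assume "f \<noteq> 0"
  then obtain z where z: "meval f z \<noteq> 0" using meval_eq_0 by blast
  obtain p where p: "poly p t = meval f (x + t *s (z - x))" for t
    using meval_line_poly by blast
  have "poly p 1 \<noteq> 0" using z by (simp add: p)
  then have fin: "finite {t. poly p t = 0}" by (intro poly_roots_finite) auto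
  have "((\<lambda>t. x + t *s (z - x)) \<longlongrightarrow> x + 0 *s (z - x)) (at 0)"
    by (intro vec_tendstoI) (auto intro!: tendsto_eq_intros)
  then have "\<forall>\<^sub>F t in at 0. x + t *s (z - x) \<in> U"
    using assms(1,2) by (intro topological_tendstoD[where S = U]) auto
  \<comment> \<open>The filter \<open>at 0\<close> omits 0 itself, so the finite root set is avoided
    although it contains 0.\<close>
  moreover have "\<forall>\<^sub>F t in at 0. t \<notin> {t. poly p t = 0}"
    using islimpt_finite[OF fin, of 0] by (auto simp: islimpt_iff_eventually)
  ultimately have "\<forall>\<^sub>F t in at (0::complex). t \<noteq> t"
    by eventually_elim (use p assms(3) in auto)
  then show False by simp
qed

subsection \<open>Factorization\<close>

text \<open>Restriction to the line joining a non-zero of \<open>f\<close> to a non-zero of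
  \<open>g\<close> gives two nonzero univariate polynomials, whose product cannot be zero.\<close>

lemma cpoly_mult_eq_0:
  fixes f g :: "'n::finite cpoly"
  assumes "f * g = 0"
  shows "f = 0 \<or> g = 0"
proof (rule ccontr)
  assume "\<not> ?thesis"
  then obtain x y where xy: "meval f x \<noteq> 0" "meval g y \<noteq> 0"
    using meval_eq_0 by metis
  obtain p where p: "\<And>t. poly p t = meval f (x + t *s (y - x))"
    using meval_line_poly by blast
  obtain q where q: "\<And>t. poly q t = meval g (x + t *s (y - x))"
    using meval_line_poly by blast
  have "poly (p * q) t = 0" for t
    using assms by (simp add: p q flip: meval_mult)
  then have "p * q = 0" using poly_all_0_iff_0 by blast
  moreover have "poly p 0 \<noteq> 0" "poly q 1 \<noteq> 0" using xy by (simp_all add: p q)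
  ultimately show False by auto
qed

lemma cpoly_mult_eq_0_iff [simp]:
  fixes f g :: "'n::finite cpoly"
  shows "f * g = 0 \<longleftrightarrow> f = 0 \<or> g = 0"
  using cpoly_mult_eq_0[of f g] by auto

lemma cpoly_power_eq_0_iff [simp]:
  fixes f :: "'n::finite cpoly"
  shows "f ^ k = 0 \<longleftrightarrow> f = 0 \<and> k > 0"
  by (induction k) auto

lemma cpoly_mult_cancel:
  fixes f g h :: "'n::finite cpoly"
  shows "f * g = f * h \<Longrightarrow> f \<noteq> 0 \<Longrightarrow> g = h"
  using cpoly_mult_eq_0[of f "g - h"] by (simp add: algebra_simps)

section \<open>Degrees, units and existence of factorizations\<close>

lemma degree_up_mult:
  fixes f g :: "'n::finite cpoly"
  assumes "f \<noteq> 0" "g \<noteq> 0"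
  shows "degree (up v (f * g)) = degree (up v f) + degree (up v g)"
proof (rule antisym)
  have "coeff (up v f * up v g) (degree (up v f) + degree (up v g)) \<noteq> 0"
    using assms by (simp add: coeff_mult_degree_sum)
  then show "degree (up v f) + degree (up v g) \<le> degree (up v (f * g))"
    by (simp add: up_mult le_degree)
qed (simp add: up_mult degree_mult_le)

lemma polys_in_dvd:
  fixes f g :: "'n::finite cpoly"
  assumes "g dvd f" "f \<in> polys_in V" "f \<noteq> 0"
  shows "g \<in> polys_in V"
  using assms by (auto simp: polys_in_iff degree_up_mult elim!: dvdE)

text \<open>Not the usual total degree, but likewise additive on products of nonzero polynomials and
  zero only on constants, as an induction measure for factorization requires.\<close>

definition total_deg :: "'n::finite cpoly \<Rightarrow> nat" where
  "total_deg f = (\<Sum>v\<in>UNIV. degree (up v f))"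

lemma total_deg_mult: "f \<noteq> 0 \<Longrightarrow> g \<noteq> 0 \<Longrightarrow> total_deg (f * g) = total_deg f + total_deg g"
  by (simp add: total_deg_def degree_up_mult sum.distrib)

lemma Const_mult: "Const a * Const b = Const (a * b)"
  by (simp add: Const_def mult_single)

lemma Const_1 [simp]: "Const 1 = 1"
  by (simp add: Const_def)

lemma Const_0 [simp]: "Const 0 = 0"
  by (simp add: Const_def)

lemma Const_eq_0_iff [simp]: "Const a = 0 \<longleftrightarrow> a = 0"
  by (metis Const_def lookup_single_eq lookup_zero single_zero)

lemma Const_dvd_1: "a \<noteq> 0 \<Longrightarrow> Const a dvd 1"
  by (rule dvdI[of _ _ "Const (1 / a)"]) (simp add: Const_mult)

lemma total_deg_eq_0:
  assumes "total_deg f = 0"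
  obtains a where "f = Const a"
proof -
  have "f \<in> polys_in {}" using assms by (simp add: total_deg_def polys_in_iff)
  then show ?thesis using polys_in_eq_Const that by blast
qed

lemma cpoly_unit_iff:
  fixes f :: "'n::finite cpoly"
  shows "f dvd 1 \<longleftrightarrow> f \<noteq> 0 \<and> total_deg f = 0"
proof
  assume "f dvd 1"
  then obtain g where g: "1 = f * g" by (elim dvdE)
  then have "f \<noteq> 0" "g \<noteq> 0" by (metis mult_zero_left mult_zero_right zero_neq_one)+
  moreover have "total_deg (f * g) = 0"
    unfolding g[symmetric] total_deg_def Const_1[symmetric] by (simp del: Const_1)
  ultimately show "f \<noteq> 0 \<and> total_deg f = 0" by (simp add: total_deg_mult)
next
  assume "f \<noteq> 0 \<and> total_deg f = 0"
  then show "f dvd 1" by (metis total_deg_eq_0 Const_dvd_1 Const_eq_0_iff)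
qed

lemma cpoly_unitE:
  fixes f :: "'n::finite cpoly"
  assumes "f dvd 1"
  obtains a where "a \<noteq> 0" "f = Const a"
  using assms by (metis cpoly_unit_iff total_deg_eq_0 Const_eq_0_iff)

text \<open>A non-unit divisor of least \<open>total_deg\<close> is irreducible: in a factorization
  into non-units both factors would have positive degree, so each would be a smaller non-unit
  divisor.\<close>

lemma irreducible_dvd_exists:
  fixes f :: "'n::finite cpoly"
  assumes "f \<noteq> 0" "\<not> f dvd 1"
  obtains p g where "irreducible p" "f = p * g" "g \<noteq> 0" "total_deg g < total_deg f"
proof -
  obtain p where p: "p dvd f" "\<not> p dvd 1"
    and least: "\<And>q. q dvd f \<Longrightarrow> \<not> q dvd 1 \<Longrightarrow> total_deg p \<le> total_deg q"
    using ex_has_least_nat[of "\<lambda>p. p dvd f \<and> \<not> p dvd 1" f total_deg] assms by auto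
  from p obtain g where g: "f = p * g" by (elim dvdE)
  have nz: "p \<noteq> 0" "g \<noteq> 0" using g assms by auto
  have "irreducible p"
  proof (rule irreducibleI)
    fix a b assume ab: "p = a * b"
    show "a dvd 1 \<or> b dvd 1"
    proof (rule ccontr)
      assume *: "\<not> ?thesis"
      have "a \<noteq> 0" "b \<noteq> 0" using ab nz by auto
      moreover have "a dvd f" using g ab by auto
      ultimately have "total_deg b = 0"
        using least[of a] * by (simp add: ab total_deg_mult)
      then show False using * \<open>b \<noteq> 0\<close> by (simp add: cpoly_unit_iff)
    qed
  qed (use nz p in auto)
  moreover have "total_deg g < total_deg f"
    using p nz by (simp add: g total_deg_mult cpoly_unit_iff)
  ultimately show ?thesis using that g nz by blast
qed

lemma cpoly_factor_induct [consumes 1, case_names Const mult]: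
  fixes f :: "'n::finite cpoly"
  assumes "f \<noteq> 0"
    and "\<And>a. a \<noteq> 0 \<Longrightarrow> P (Const a)"
    and "\<And>p g. irreducible p \<Longrightarrow> g \<noteq> 0 \<Longrightarrow> P g \<Longrightarrow> P (p * g)"
  shows "P f"
  using assms(1)
proof (induction f rule: measure_induct_rule[of total_deg])
  case (less f)
  show ?case
  proof (cases "f dvd 1")
    case True
    then show ?thesis using assms(2) by (metis cpoly_unitE)
  next
    case False
    with less.prems obtain p g where "irreducible p" "f = p * g" "g \<noteq> 0" "total_deg g < total_deg f"
      using irreducible_dvd_exists by blast
    then show ?thesis using less.IH assms(3) by blast
  qed
qed

text \<open>Induction over a factorization. A new factor \<open>p\<close> either is a constant
  multiple of some \<open>q\<close> in \<open>Q\<close>, whose exponent then grows while the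
  constant is absorbed into \<open>a\<close>, or it joins \<open>Q\<close> with exponent 1.\<close>

lemma is_rad_exists:
  fixes f :: "'n::finite cpoly"
  assumes "f \<noteq> 0"
  shows "\<exists>r. is_rad f r"
  using assms
proof (induction f rule: cpoly_factor_induct)
  case (Const a)
  then have "is_rad (Const a) 1"
    unfolding is_rad_def by (intro exI[of _ "{}"] exI[of _ a]) auto
  then show ?case by blast
next
  case (mult p g)
  then obtain r where "is_rad g r" by blast
  then obtain Q m a where Q: "finite Q" "\<forall>q\<in>Q. irreducible q \<and> m q > (0::nat)"
    and dist: "\<forall>q\<in>Q. \<forall>q'\<in>Q. \<forall>b. q' = Const b * q \<longrightarrow> q' = q"
    and a: "a \<noteq> 0" and g: "g = Const a * (\<Prod>q\<in>Q. q ^ m q)"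
    unfolding is_rad_def by (elim exE conjE)
  show ?case
  proof (cases "\<exists>q\<in>Q. \<exists>b. q = Const b * p")
    case True
    then obtain q b where q: "q \<in> Q" "q = Const b * p" by blast
    have b: "b \<noteq> 0"
      using bspec[OF Q(2) q(1)] q(2) by auto
    have p: "p = Const (1 / b) * q"
      using b by (simp add: q(2) Const_mult flip: mult.assoc)
    define n where "n = m(q := Suc (m q))"
    have "(\<Prod>q\<in>Q. q ^ n q) = q * (\<Prod>q\<in>Q. q ^ m q)"
      using Q(1) q(1) by (simp add: prod.remove[of _ q] n_def mult_ac)
    moreover have "p * g = Const (1 / b) * Const a * (q * (\<Prod>q\<in>Q. q ^ m q))"
      by (simp add: g p mult_ac)
    ultimately have eq: "p * g = Const (a / b) * (\<Prod>q\<in>Q. q ^ n q)"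
      by (simp add: Const_mult)
    have "\<forall>q\<in>Q. irreducible q \<and> n q > 0"
      using Q(2) by (auto simp: n_def)
    moreover have "a / b \<noteq> 0" using a b by simp
    ultimately have "is_rad (p * g) (\<Prod>Q)"
      unfolding is_rad_def using Q(1) dist eq by blast
    then show ?thesis by blast
  next
    case False
    have pQ: "p \<notin> Q" using False by (metis Const_1 mult_1)
    define n where "n = m(p := 1)"
    have "(\<Prod>q\<in>Q. q ^ n q) = (\<Prod>q\<in>Q. q ^ m q)"
      using pQ by (intro prod.cong) (auto simp: n_def)
    then have eq: "p * g = Const a * (\<Prod>q\<in>insert p Q. q ^ n q)"
      using Q(1) pQ by (simp add: g n_def mult_ac)
    have pq: "q = p" if q: "q \<in> Q" "p = Const b * q" for q b
    proof -
      have "b \<noteq> 0" using q(2) mult(1) by auto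
      then have "q = Const (1 / b) * p"
        by (simp add: q(2) Const_mult flip: mult.assoc)
      with False q(1) show ?thesis by blast
    qed
    have dist': "\<forall>q\<in>insert p Q. \<forall>q'\<in>insert p Q. \<forall>b. q' = Const b * q \<longrightarrow> q' = q"
    proof (intro ballI allI impI)
      fix q q' b assume "q \<in> insert p Q" "q' \<in> insert p Q" and eq: "q' = Const b * q"
      then consider "q = p" "q' = p" | "q = p" "q' \<in> Q" | "q \<in> Q" "q' = p" | "q \<in> Q" "q' \<in> Q"
        by blast
      then show "q' = q"
      proof cases
        case 2
        then show ?thesis using eq False by metis
      next
        case 3
        then show ?thesis using eq pq[of q b] by metis
      next
        case 4
        then show ?thesis using dist eq by metis
      qed simp
    qed
    have "\<forall>q\<in>insert p Q. irreducible q \<and> n q > 0"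
      using Q(2) mult(1) by (auto simp: n_def)
    then have "is_rad (p * g) (\<Prod>(insert p Q))"
      unfolding is_rad_def using Q(1) dist' a eq by (intro exI conjI) auto
    then show ?thesis by blast
  qed
qed

lemma is_rad_rad: "f \<noteq> 0 \<Longrightarrow> is_rad f (rad f)" for f :: "'n::finite cpoly"
  unfolding rad_def by (rule someI_ex) (rule is_rad_exists)

text \<open>
  Gauss's lemma is proved by adjoining the variables one at a time. The base ring has to be a subset
  rather than a type, since the induction is on the set of variables.
\<close>

definition irreducibles_prime :: "'n set \<Rightarrow> bool" where
  "irreducibles_prime V \<longleftrightarrow> (\<forall>q\<in>polys_in V. irreducible q \<longrightarrow>
     (\<forall>g\<in>polys_in V. \<forall>h\<in>polys_in V. q dvd g * h \<longrightarrow> q dvd g \<or> q dvd h))"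

text \<open>A polynomial free of \<open>v\<close> acts as a scalar under \<open>up v\<close>, so
  divisibility by it is tested coefficientwise.\<close>

lemma dvd_iff_dvd_coeff_up:
  fixes q g :: "'n::finite cpoly"
  assumes "q \<in> polys_in V" "v \<notin> V"
  shows "q dvd g \<longleftrightarrow> (\<forall>k. q dvd coeff (up v g) k)"
proof
  assume "q dvd g"
  then obtain s where "g = q * s" by (elim dvdE)
  then show "\<forall>k. q dvd coeff (up v g) k"
    by (simp add: up_mult up_polys_in[OF assms])
next
  assume "\<forall>k. q dvd coeff (up v g) k"
  then have "q dvd poly (up v g) (Var v)"
    unfolding poly_altdef by (intro dvd_sum dvd_mult2) auto
  then show "q dvd g" by (simp add: poly_up_Var)
qed

text \<open>Gauss's argument: let \<open>k\<close> and \<open>l\<close> index the first coefficients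
  of \<open>g\<close> and \<open>h\<close> not divisible by \<open>q\<close>. Modulo
  \<open>q\<close>, coefficient \<open>k + l\<close> of the product is the product of these two, and
  \<open>q\<close> is prime over \<open>V\<close>.\<close>

lemma irreducible_prime_insert:
  fixes q g h :: "'n::finite cpoly"
  assumes V: "irreducibles_prime V" "v \<notin> V" and q: "q \<in> polys_in V" "irreducible q"
    and gh: "g \<in> polys_in (insert v V)" "h \<in> polys_in (insert v V)" "q dvd g * h"
  shows "q dvd g \<or> q dvd h"
proof (rule ccontr)
  assume *: "\<not> ?thesis"
  define k where "k = (LEAST k. \<not> q dvd coeff (up v g) k)"
  define l where "l = (LEAST k. \<not> q dvd coeff (up v h) k)"
  note dvd = dvd_iff_dvd_coeff_up[OF q(1) V(2)]
  have kl: "\<not> q dvd coeff (up v g) k" "\<not> q dvd coeff (up v h) l"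
    unfolding k_def l_def using * by (metis (mono_tags, lifting) LeastI_ex dvd)+
  have less: "q dvd coeff (up v g) i" if "i < k" for i
    using that not_less_Least unfolding k_def by blast
  have less': "q dvd coeff (up v h) i" if "i < l" for i
    using that not_less_Least unfolding l_def by blast
  let ?c = "\<lambda>i. coeff (up v g) i * coeff (up v h) (k + l - i)"
  have "coeff (up v (g * h)) (k + l) = ?c k + (\<Sum>i\<in>{..k + l} - {k}. ?c i)"
    unfolding up_mult coeff_mult by (subst sum.remove[of _ k]) auto
  moreover have "q dvd (\<Sum>i\<in>{..k + l} - {k}. ?c i)"
  proof (rule dvd_sum)
    fix i assume "i \<in> {..k + l} - {k}"
    then have "i < k \<or> k + l - i < l" by auto
    then show "q dvd ?c i" using less less' by auto
  qed
  moreover have "q dvd coeff (up v (g * h)) (k + l)" using gh(3) dvd by blast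
  ultimately have "q dvd ?c k"
    using dvd_diff[of q "coeff (up v (g * h)) (k + l)" "\<Sum>i\<in>{..k + l} - {k}. ?c i"] by simp
  then have "q dvd coeff (up v g) k * coeff (up v h) l" by simp
  moreover have "coeff (up v g) k \<in> polys_in V" "coeff (up v h) l \<in> polys_in V"
    using gh by (auto intro: polys_in_coeff_up)
  ultimately show False using V(1) q kl unfolding irreducibles_prime_def by blast
qed

text \<open>Replaces the passage to the field of fractions in Gauss's lemma.\<close>

lemma distribute_factors:
  fixes c f w s :: "'n::finite cpoly"
  assumes V: "irreducibles_prime V" "v \<notin> V"
    and "c \<noteq> 0" "c \<in> polys_in V" "f \<noteq> 0" "f \<in> polys_in (insert v V)" "c * f = w * s"
  shows "\<exists>c1 c2 w' s'. c1 \<in> polys_in V \<and> c2 \<in> polys_in V \<and> w = c1 * w' \<and> s = c2 * s' \<and> f = w' * s'"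
  using assms(3-)
proof (induction c arbitrary: w s rule: cpoly_factor_induct)
  case (Const a)
  have "f = Const (1 / a) * (Const a * f)"
    using Const(1) by (simp add: Const_mult flip: mult.assoc)
  also have "\<dots> = (Const (1 / a) * w) * s"
    by (simp add: Const mult.assoc)
  finally have "f = (Const (1 / a) * w) * s" .
  moreover have "w = Const a * (Const (1 / a) * w)"
    using Const(1) by (simp add: Const_mult flip: mult.assoc)
  ultimately show ?case using polys_in_Const polys_in_1 by (metis mult_1)
next
  case (mult p g)
  have pg: "p * g \<noteq> 0" using mult by auto
  then have p: "p \<in> polys_in V" and g: "g \<in> polys_in V"
    using polys_in_dvd[OF _ mult.prems(1)] by auto
  \<comment> \<open>The factors \<open>w\<close> and \<open>s\<close> inherit membership as divisors
    of a nonzero element.\<close>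
  have C: "(p * g) * f \<in> polys_in (insert v V)"
    using mult.prems polys_in_mono[of V "insert v V"] by blast
  moreover have nz: "w * s \<noteq> 0" using mult.prems pg by (metis cpoly_mult_eq_0_iff)
  ultimately have ws: "w \<in> polys_in (insert v V)" "s \<in> polys_in (insert v V)"
    using polys_in_dvd[of w "w * s"] polys_in_dvd[of s "w * s"] mult.prems(4) by auto
  have "p dvd w * s" using mult.prems(4) by (metis dvd_triv_left mult.assoc)
  then have "p dvd w \<or> p dvd s" by (intro irreducible_prime_insert[OF V p mult(1) ws])
  then show ?case
  proof
    assume "p dvd w"
    then obtain w1 where w1: "w = p * w1" by (elim dvdE)
    then have "p * (g * f) = p * (w1 * s)" using mult.prems by (simp add: mult_ac)
    then have "g * f = w1 * s" using pg by (metis cpoly_mult_cancel mult_zero_left)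
    then have "\<exists>c1 c2 w' s'. c1 \<in> polys_in V \<and> c2 \<in> polys_in V \<and> w1 = c1 * w' \<and> s = c2 * s' \<and> f = w' * s'"
      using mult.IH g mult.prems(2,3) by presburger
    then obtain c1 c2 w' s' where *: "c1 \<in> polys_in V" "c2 \<in> polys_in V" "w1 = c1 * w'" "s = c2 * s'" "f = w' * s'"
      by (elim exE conjE)
    have "p * c1 \<in> polys_in V" "w = (p * c1) * w'" using * p w1 by (auto simp: mult.assoc)
    then show ?thesis using *(2,4,5) by blast
  next
    assume "p dvd s"
    then obtain s1 where s1: "s = p * s1" by (elim dvdE)
    then have "p * (g * f) = p * (w * s1)" using mult.prems by (simp add: mult_ac)
    then have "g * f = w * s1" using pg by (metis cpoly_mult_cancel mult_zero_left)
    then have "\<exists>c1 c2 w' s'. c1 \<in> polys_in V \<and> c2 \<in> polys_in V \<and> w = c1 * w' \<and> s1 = c2 * s' \<and> f = w' * s'"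
      using mult.IH g mult.prems(2,3) by presburger
    then obtain c1 c2 w' s' where *: "c1 \<in> polys_in V" "c2 \<in> polys_in V" "w = c1 * w'" "s1 = c2 * s'" "f = w' * s'"
      by (elim exE conjE)
    have "p * c2 \<in> polys_in V" "s = (p * c2) * s'" using * p s1 by (auto simp: mult.assoc)
    then show ?thesis using *(1,3,5) by blast
  qed
qed

text \<open>Distributing the factors of \<open>c\<close> over the product \<open>f * z\<close>
  splits \<open>f\<close> as \<open>c1 * f'\<close>. Since \<open>f\<close> really involves
  \<open>v\<close>, the unit must be \<open>c1\<close>, and \<open>f\<close> divides
  \<open>g\<close> along with \<open>f'\<close>.\<close>

lemma irreducible_dvd_cancel:
  fixes c f g :: "'n::finite cpoly"
  assumes V: "irreducibles_prime V" "v \<notin> V"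
    and c: "c \<noteq> 0" "c \<in> polys_in V" and g: "g \<in> polys_in (insert v V)"
    and f: "irreducible f" "degree (up v f) > 0" and dvd: "f dvd c * g"
  shows "f dvd g"
proof (cases "g = 0")
  case False
  from dvd obtain z where "c * g = f * z" by (elim dvdE)
  then obtain c1 c2 f' z' where *: "c1 \<in> polys_in V" "f = c1 * f'" "g = f' * z'"
    using distribute_factors[OF V c False g] by metis
  have "f' dvd 1 \<or> c1 dvd 1" using f(1) * by (metis irreducibleD)
  then show ?thesis
  proof
    assume "f' dvd 1"
    then obtain b where "f' = Const b" by (rule cpoly_unitE)
    then have "f \<in> polys_in V" using * by auto
    then have False using f(2) V(2) by (simp add: polys_in_iff)
    then show ?thesis ..
  next
    assume "c1 dvd 1"
    then have "f dvd f'" unfolding *(2)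
      by (metis dvd_refl mult_1 mult_dvd_mono)
    then show ?thesis using *(3) by auto
  qed
qed auto

text \<open>Division with remainder in the variable \<open>v\<close>; powers of the leading
  coefficient of \<open>w\<close> avoid any division by it. The alternative \<open>u = 0\<close>
  covers a divisor of degree 0 in \<open>v\<close>.\<close>

lemma pseudo_division:
  fixes p w :: "'n::finite cpoly"
  assumes "p \<in> polys_in (insert v V)" "w \<in> polys_in (insert v V)"
  shows "\<exists>N s u. s \<in> polys_in (insert v V) \<and> u \<in> polys_in (insert v V) \<and>
    lead_coeff (up v w) ^ N * p = w * s + u \<and> (u = 0 \<or> degree (up v u) < degree (up v w))"
  using assms(1)
proof (induction p rule: measure_induct_rule[of "\<lambda>p. degree (up v p)"])
  case (less p)
  show ?case
  proof (cases "p = 0 \<or> degree (up v p) < degree (up v w)")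
    case True
    then show ?thesis
      using less.prems by (intro exI[of _ 0] exI[of _ p]) auto
  next
    case False
    define L where "L = lead_coeff (up v w)"
    define M where "M = lead_coeff (up v p)"
    define d where "d = degree (up v p) - degree (up v w)"
    \<comment> \<open>Cross multiplication by the leading coefficients cancels the leading terms in
      \<open>v\<close>.\<close>
    define p1 where "p1 = L * p - Var v ^ d * (M * w)"
    have sub: "polys_in V \<subseteq> polys_in (insert v V)" by (rule polys_in_mono) auto
    have L: "L \<in> polys_in (UNIV - {v})" "M \<in> polys_in (UNIV - {v})"
      unfolding L_def M_def by (auto intro!: polys_in_coeff_up simp: insert_UNIV)
    have LC: "L \<in> polys_in (insert v V)" "M \<in> polys_in (insert v V)"
      unfolding L_def M_def
      using subsetD[OF sub polys_in_coeff_up[OF assms(2)]] subsetD[OF sub polys_in_coeff_up[OF less.prems]]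
      by auto
    then have p1C: "p1 \<in> polys_in (insert v V)"
      unfolding p1_def using assms(2) less.prems
      by (intro polys_in_diff polys_in_mult polys_in_power polys_in_Var) auto
    have up1: "up v p1 = smult L (up v p) - monom 1 d * smult M (up v w)"
      using up_polys_in[OF L(1)] up_polys_in[OF L(2)]
      by (simp add: p1_def up_diff up_mult[of v L] up_mult[of v M] up_Var_power_mult)
    have "degree (monom 1 d * smult M (up v w)) \<le> d + degree (up v w)"
      by (rule order.trans[OF degree_mult_le]) (intro add_mono degree_monom_le degree_smult_le)
    then have "degree (up v p1) \<le> degree (up v p)"
      unfolding up1 using False by (intro degree_diff_le degree_smult_le) (auto simp: d_def)
    moreover have "coeff (up v p1) (degree (up v p)) = 0"
      using False by (simp add: up1 coeff_monom_mult d_def L_def M_def mult.commute[of "lead_coeff (up v w)"])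
    ultimately consider "p1 = 0" | "degree (up v p1) < degree (up v p)"
      by (metis le_neq_implies_less leading_coeff_0_iff up_eq_0_iff)
    then show ?thesis
    proof cases
      case 1
      then have "L ^ 1 * p = w * (Var v ^ d * M) + 0" by (simp add: p1_def algebra_simps)
      moreover have "Var v ^ d * M \<in> polys_in (insert v V)"
        using LC by (intro polys_in_mult polys_in_power polys_in_Var) auto
      ultimately show ?thesis unfolding L_def by (metis polys_in_0)
    next
      case 2
      then obtain N s u where *: "s \<in> polys_in (insert v V)" "u \<in> polys_in (insert v V)"
        "L ^ N * p1 = w * s + u" "u = 0 \<or> degree (up v u) < degree (up v w)"
        using less.IH p1C unfolding L_def by blast
      have "L ^ Suc N * p = w * (s + L ^ N * (Var v ^ d * M)) + u"
        using *(3) by (simp add: p1_def algebra_simps)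
      moreover have "s + L ^ N * (Var v ^ d * M) \<in> polys_in (insert v V)"
        using LC * by (intro polys_in_add polys_in_mult polys_in_power polys_in_Var) auto
      ultimately show ?thesis using * unfolding L_def by blast
    qed
  qed
qed

text \<open>A nonzero element \<open>w\<close> of the ideal \<open>(f, g)\<close> of least degree in \<open>x\<^sub>v\<close> divides \<open>f\<close> and \<open>g\<close> up to
  factors free of \<open>x\<^sub>v\<close>; since \<open>f\<close> is irreducible, \<open>w\<close> is then free of \<open>x\<^sub>v\<close> itself.\<close>

lemma eliminate_variable:
  fixes f g :: "'n::finite cpoly"
  assumes V: "irreducibles_prime V" "v \<notin> V"
    and f: "f \<in> polys_in (insert v V)" "irreducible f" "degree (up v f) > 0"
    and g: "g \<in> polys_in (insert v V)" "\<not> f dvd g"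
  shows "\<exists>c a b. c \<in> polys_in V \<and> c \<noteq> 0 \<and> a \<in> polys_in (insert v V) \<and> b \<in> polys_in (insert v V) \<and>
    c = f * a + g * b"
proof -
  let ?C = "polys_in (insert v V)"
  define J where "J = {w. \<exists>a\<in>?C. \<exists>b\<in>?C. w = f * a + g * b}"
  have f0: "f \<noteq> 0" using f by auto
  have "f = f * 1 + g * 0" by simp
  then have fJ: "f \<in> J" unfolding J_def using polys_in_0 polys_in_1 by blast
  have "g = f * 0 + g * 1" by simp
  then have gJ: "g \<in> J" unfolding J_def using polys_in_0 polys_in_1 by blast
  obtain w where w: "w \<in> J" "w \<noteq> 0"
    and least: "\<And>u. u \<in> J \<Longrightarrow> u \<noteq> 0 \<Longrightarrow> degree (up v w) \<le> degree (up v u)"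
    using ex_has_least_nat[of "\<lambda>w. w \<in> J \<and> w \<noteq> 0" f "\<lambda>w. degree (up v w)"] fJ f0 by blast
  from w obtain a b where ab: "a \<in> ?C" "b \<in> ?C" "w = f * a + g * b" unfolding J_def by blast
  have wC: "w \<in> ?C" using ab f g by auto
  define L where "L = lead_coeff (up v w)"
  have L: "L \<in> polys_in V" "L \<noteq> 0"
    using polys_in_coeff_up[OF wC] w by (auto simp: L_def)
  have LC: "L \<in> ?C" using L polys_in_mono[of V "insert v V"] by blast
  \<comment> \<open>The pseudo-remainder of \<open>p\<close> by \<open>w\<close> is again in
    \<open>J\<close>, so the minimality of \<open>w\<close> forces it to be zero.\<close>
  have div: "\<exists>N s. L ^ N * p = w * s" if "p \<in> J" for p
  proof -
    from that obtain a' b' where ab': "a' \<in> ?C" "b' \<in> ?C" "p = f * a' + g * b'"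
      unfolding J_def by blast
    then have "p \<in> ?C" using f g by auto
    then obtain N s u where *: "s \<in> ?C" "u \<in> ?C" "L ^ N * p = w * s + u"
        "u = 0 \<or> degree (up v u) < degree (up v w)"
      using pseudo_division[OF _ wC] unfolding L_def by blast
    have "u = f * (L ^ N * a' - a * s) + g * (L ^ N * b' - b * s)"
      using *(3) by (simp add: ab(3) ab'(3) algebra_simps)
    moreover have "L ^ N * a' - a * s \<in> ?C" "L ^ N * b' - b * s \<in> ?C"
      using ab ab' * LC by auto
    ultimately have "u \<in> J" unfolding J_def by blast
    with least *(4) have "u = 0" by force
    with * show ?thesis by auto
  qed
  obtain N s where "L ^ N * f = w * s" using div[OF fJ] by blast
  moreover have "L ^ N \<noteq> 0" "L ^ N \<in> polys_in V" for N using L by auto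
  ultimately obtain c1 c2 w' s' where *: "c1 \<in> polys_in V" "w = c1 * w'" "f = w' * s'"
    using distribute_factors[OF V _ _ f0 f(1)] by metis
  \<comment> \<open>In the first case \<open>w\<close> is a constant times \<open>c1\<close>, hence
    free of \<open>v\<close>. In the second \<open>f\<close> divides \<open>w\<close>, thus a power
    of \<open>L\<close> times \<open>g\<close>, and after cancellation \<open>g\<close>
    itself.\<close>
  have "w' dvd 1 \<or> s' dvd 1" using f(2) * by (metis irreducibleD)
  then show ?thesis
  proof
    assume "w' dvd 1"
    then obtain b where "w' = Const b" by (rule cpoly_unitE)
    then have "w \<in> polys_in V" using * by auto
    then show ?thesis using w ab by blast
  next
    assume "s' dvd 1"
    then have "f dvd w'" unfolding *(3) by (metis dvd_refl mult_1_right mult_dvd_mono)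
    then have "f dvd w" using * by auto
    moreover obtain M t where "L ^ M * g = w * t" using div[OF gJ] by blast
    ultimately have "f dvd L ^ M * g" by auto
    then have "f dvd g"
      using L by (intro irreducible_dvd_cancel[OF V _ _ g(1) f(2,3)]) auto
    with g show ?thesis by blast
  qed
qed

text \<open>Over no variables every nonzero element is a unit. When \<open>v\<close> is adjoined, an
  \<open>f\<close> free of \<open>v\<close> is handled by Gauss's argument. Otherwise a relation
  \<open>c = f * a + g * b\<close> multiplied by \<open>h\<close> shows that \<open>f\<close>
  divides \<open>c * h\<close>, and \<open>c\<close> can be cancelled.\<close>

lemma irreducibles_prime_all: "irreducibles_prime (V :: 'n::finite set)"
proof -
  have "finite V" by simp
  then show ?thesis
  proof (induction V)
    case empty
    have False if "q \<in> polys_in {}" "irreducible q" for q :: "'n cpoly"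
      using that by (metis polys_in_eq_Const Const_dvd_1 Const_eq_0_iff irreducible_def)
    then show ?case unfolding irreducibles_prime_def by blast
  next
    case (insert v V)
    note V = insert.IH insert.hyps(2)
    show ?case
      unfolding irreducibles_prime_def
    proof (intro ballI impI)
      fix f g h :: "'n cpoly"
      assume f: "f \<in> polys_in (insert v V)" "irreducible f"
        and g: "g \<in> polys_in (insert v V)" and h: "h \<in> polys_in (insert v V)"
        and dvd: "f dvd g * h"
      show "f dvd g \<or> f dvd h"
      proof (cases "degree (up v f) = 0")
        case True
        with f(1) have "f \<in> polys_in V" unfolding polys_in_iff by (metis insertE)
        then show ?thesis using irreducible_prime_insert[OF V _ f(2) g h dvd] by blast
      next
        case False
        have "f dvd h" if ndvd: "\<not> f dvd g"
        proof -
          obtain c a b where c: "c \<in> polys_in V" "c \<noteq> 0" "c = f * a + g * b"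
            using eliminate_variable[OF V f _ g ndvd] False by auto
          have "c * h = f * (a * h) + (g * h) * b" by (simp add: c(3) algebra_simps)
          also have "f dvd \<dots>" using dvd by (intro dvd_add) auto
          finally show "f dvd h"
            using False by (intro irreducible_dvd_cancel[OF V c(2,1) h f(2)]) auto
        qed
        then show ?thesis by blast
      qed
    qed
  qed
qed

lemma irreducible_imp_prime_cpoly:
  fixes q g h :: "'n::finite cpoly"
  shows "irreducible q \<Longrightarrow> q dvd g * h \<Longrightarrow> q dvd g \<or> q dvd h"
  using irreducibles_prime_all[of "UNIV :: 'n set"]
  unfolding irreducibles_prime_def polys_in_UNIV by blast

subsection \<open>Zeros along a coordinate direction\<close>

text \<open>The value at 0 fills the removable singularity. Zeros at \<open>t \<noteq> 0\<close> are
  repetitions of the value \<open>f 0\<close>, and a zero at 0 is a critical point.\<close>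

definition diff_quot :: "(complex \<Rightarrow> complex) \<Rightarrow> complex \<Rightarrow> complex" where
  "diff_quot f t = (if t = 0 then deriv f 0 else (f t - f 0) / t)"

lemma holomorphic_diff_quot:
  assumes "f holomorphic_on ball 0 R"
  shows "diff_quot f holomorphic_on ball 0 R"
  using pole_lemma_open[OF assms open_ball, of 0] by (simp add: diff_quot_def[abs_def] cong: if_cong)

text \<open>A direct estimate fails near 0, where the denominator is small. The maximum modulus
  principle moves it to the circle of radius \<open>\<rho>\<close>, where division costs only the
  factor \<open>1 / \<rho>\<close>.\<close>

lemma uniform_limit_diff_quot:
  assumes f: "\<forall>\<^sub>F n in F. f n holomorphic_on ball 0 R" and g: "g holomorphic_on ball 0 R"
    and lim: "uniform_limit (cball 0 \<rho>) f g F" and \<rho>: "0 < \<rho>" "\<rho> < R"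
  shows "uniform_limit (cball 0 \<rho>) (\<lambda>n. diff_quot (f n)) (diff_quot g) F"
proof (rule uniform_limitI)
  fix e :: real assume e: "e > 0"
  \<comment> \<open>The values at \<open>z\<close> and at 0 each contribute one such error; divided
    by \<open>\<rho>\<close>, together they give \<open>e / 2\<close>.\<close>
  have "\<forall>\<^sub>F n in F. \<forall>t\<in>cball 0 \<rho>. dist (f n t) (g t) < e * \<rho> / 4"
    using uniform_limitD[OF lim, of "e * \<rho> / 4"] e \<rho> by simp
  then show "\<forall>\<^sub>F n in F. \<forall>t\<in>cball 0 \<rho>. dist (diff_quot (f n) t) (diff_quot g t) < e"
    using f
  proof eventually_elim
    case (elim n)
    have hol: "(\<lambda>t. diff_quot (f n) t - diff_quot g t) holomorphic_on ball 0 R"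
      by (intro holomorphic_on_diff holomorphic_diff_quot elim(2) g)
    show ?case
    proof
      fix t :: complex assume t: "t \<in> cball 0 \<rho>"
      have "norm (diff_quot (f n) t - diff_quot g t) \<le> e / 2"
      proof (rule maximum_modulus_frontier[of "\<lambda>t. diff_quot (f n) t - diff_quot g t" "cball 0 \<rho>"])
        show "(\<lambda>t. diff_quot (f n) t - diff_quot g t) holomorphic_on interior (cball 0 \<rho>)"
          using \<rho> by (intro holomorphic_on_subset[OF hol]) auto
        show "continuous_on (closure (cball 0 \<rho>)) (\<lambda>t. diff_quot (f n) t - diff_quot g t)"
          using \<rho> by (intro holomorphic_on_imp_continuous_on holomorphic_on_subset[OF hol]) auto
        fix z :: complex assume "z \<in> frontier (cball 0 \<rho>)"
        then have z: "norm z = \<rho>" using \<rho> by simp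
        then have nz: "z \<noteq> 0" using \<rho> by auto
        have "norm (f n z - g z) < e * \<rho> / 4" "norm (f n 0 - g 0) < e * \<rho> / 4"
          using elim(1) z \<rho> by (auto simp: dist_norm)
        then have "norm ((f n z - g z) - (f n 0 - g 0)) \<le> e * \<rho> / 2"
          using norm_triangle_ineq4[of "f n z - g z" "f n 0 - g 0"] by linarith
        moreover have "diff_quot (f n) z - diff_quot g z = ((f n z - g z) - (f n 0 - g 0)) / z"
          using nz by (simp add: diff_quot_def field_simps)
        ultimately show "norm (diff_quot (f n) z - diff_quot g z) \<le> e / 2"
          using \<rho> z by (simp add: norm_divide field_simps)
      qed (use t in auto)
      then show "dist (diff_quot (f n) t) (diff_quot g t) < e" using e by (simp add: dist_norm)
    qed
  qed
qed

section \<open>Continuous functions that are holomorphic along one coordinate axis\<close>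

lemma axis_add: "axis i (s + t) = axis i s + axis i (t :: 'a::monoid_add)"
  by (simp add: vec_eq_iff axis_def)

lemma axis_zero [simp]: "axis i 0 = 0"
  by (simp add: vec_eq_iff axis_def)

lemma norm_axis: "norm (axis i t :: 'a::real_normed_vector ^ 'n::finite) = norm t"
proof -
  have "(\<Sum>j\<in>UNIV. (norm (axis i t $ j))\<^sup>2) = (\<Sum>j\<in>UNIV. if j = i then (norm t)\<^sup>2 else 0)"
    by (intro sum.cong) (auto simp: axis_def)
  then show ?thesis by (simp add: norm_vec_def L2_set_def)
qed

text \<open>Joint continuity gives uniform convergence when the base point moves; holomorphy is
  needed only along lines in direction \<open>i\<close>. Polynomials and chart components both
  qualify.\<close>

definition differentiable_along :: "'n \<Rightarrow> (complex ^ 'n::finite \<Rightarrow> complex) \<Rightarrow> (complex ^ 'n) set \<Rightarrow> bool" where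
  "differentiable_along i f U \<longleftrightarrow> continuous_on U f \<and>
     (\<forall>y\<in>U. (\<lambda>t. f (y + axis i t)) field_differentiable at 0)"

lemma differentiable_along_subset:
  "differentiable_along i f U \<Longrightarrow> V \<subseteq> U \<Longrightarrow> differentiable_along i f V"
  unfolding differentiable_along_def by (blast intro: continuous_on_subset)

lemma holomorphic_along_axis:
  assumes f: "differentiable_along i f U" and T: "\<And>t. t \<in> T \<Longrightarrow> y + axis i t \<in> U"
  shows "(\<lambda>t. f (y + axis i t)) holomorphic_on T"
  unfolding holomorphic_on_def
proof
  fix t assume "t \<in> T"
  then obtain D where "((\<lambda>s. f (y + axis i t + axis i s)) has_field_derivative D) (at 0)"
    using f T unfolding differentiable_along_def field_differentiable_def by blast
  then have "((\<lambda>s. f (y + axis i (s + t))) has_field_derivative D) (at 0)"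
    by (simp add: axis_add add_ac)
  then have "((\<lambda>t. f (y + axis i t)) has_field_derivative D) (at (0 + t))"
    using DERIV_shift[of "\<lambda>t. f (y + axis i t)" D 0 t] by blast
  then show "(\<lambda>t. f (y + axis i t)) field_differentiable at t within T"
    by (auto simp: field_differentiable_def intro: has_field_derivative_at_within)
qed

lemma uniform_limit_along_axis:
  fixes f :: "complex ^ 'n::finite \<Rightarrow> complex"
  assumes f: "continuous_on (ball x R) f" and \<rho>: "0 < \<rho>" "\<rho> < R"
  shows "uniform_limit (cball 0 \<rho>) (\<lambda>y t. f (y + axis i t)) (\<lambda>t. f (x + axis i t)) (nhds x)"
proof (rule uniform_limitI)
  fix e :: real assume e: "e > 0"
  \<comment> \<open>An intermediate radius: \<open>cball x \<sigma>\<close> is a compact subset of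
    the domain, and the gap \<open>\<sigma> - \<rho>\<close> leaves room for \<open>y\<close> to
    move.\<close>
  define \<sigma> where "\<sigma> = (\<rho> + R) / 2"
  have \<sigma>: "\<rho> < \<sigma>" "\<sigma> < R" using \<rho> by (auto simp: \<sigma>_def)
  have "uniformly_continuous_on (cball x \<sigma>) f"
    using \<sigma> by (intro compact_uniformly_continuous continuous_on_subset[OF f]) auto
  then obtain d where d: "d > 0"
    "\<And>y z. y \<in> cball x \<sigma> \<Longrightarrow> z \<in> cball x \<sigma> \<Longrightarrow> dist z y < d \<Longrightarrow> dist (f z) (f y) < e"
    using e unfolding uniformly_continuous_on_def by metis
  have "\<forall>\<^sub>F y in nhds x. dist y x < min d (\<sigma> - \<rho>)"
    using d \<sigma> eventually_nhds_metric[of _ x] by (auto intro!: exI[of _ "min d (\<sigma> - \<rho>)"])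
  then show "\<forall>\<^sub>F y in nhds x. \<forall>t\<in>cball 0 \<rho>. dist (f (y + axis i t)) (f (x + axis i t)) < e"
  proof eventually_elim
    case (elim y)
    show ?case
    proof
      fix t :: complex assume t: "t \<in> cball 0 \<rho>"
      have "norm (y + axis i t - x) \<le> norm (y - x) + norm (axis i t)"
        by (metis add_diff_eq norm_triangle_ineq diff_add_eq)
      then have "y + axis i t \<in> cball x \<sigma>" "x + axis i t \<in> cball x \<sigma>"
        using t elim \<sigma> by (auto simp: dist_norm norm_axis norm_minus_commute)
      then show "dist (f (y + axis i t)) (f (x + axis i t)) < e"
        using d(2) elim by (simp add: dist_norm)
    qed
  qed
qed

lemma eventually_holomorphic_along_axis:
  assumes f: "differentiable_along i f (ball x R)" and \<rho>: "\<rho> < R"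
  shows "\<forall>\<^sub>F y in nhds x. (\<lambda>t. f (y + axis i t)) holomorphic_on ball 0 \<rho>"
proof -
  have "\<forall>\<^sub>F y in nhds x. dist y x < R - \<rho>"
    using \<rho> eventually_nhds_metric[of _ x] by (auto intro!: exI[of _ "R - \<rho>"])
  then show ?thesis
  proof eventually_elim
    case (elim y)
    have "y + axis i t \<in> ball x R" if "t \<in> ball 0 \<rho>" for t
    proof -
      have "norm (y + axis i t - x) \<le> norm (y - x) + norm (axis i t)"
        by (metis add_diff_eq norm_triangle_ineq diff_add_eq)
      then show ?thesis using that elim by (simp add: dist_norm norm_axis norm_minus_commute)
    qed
    then show ?case by (intro holomorphic_along_axis[OF f])
  qed
qed

lemma uniform_limit_diff_quot_along_axis:
  assumes f: "differentiable_along i f (ball x R)" and \<rho>: "0 < \<rho>" "\<rho> < R"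
  shows "uniform_limit (cball 0 \<rho>) (\<lambda>y. diff_quot (\<lambda>t. f (y + axis i t))) (diff_quot (\<lambda>t. f (x + axis i t))) (nhds x)"
proof (rule uniform_limit_diff_quot)
  show "\<forall>\<^sub>F y in nhds x. (\<lambda>t. f (y + axis i t)) holomorphic_on ball 0 ((\<rho> + R) / 2)"
    using \<rho> by (intro eventually_holomorphic_along_axis[OF f]) auto
  then show "(\<lambda>t. f (x + axis i t)) holomorphic_on ball 0 ((\<rho> + R) / 2)"
    by (rule eventually_nhds_x_imp_x)
  show "uniform_limit (cball 0 \<rho>) (\<lambda>y t. f (y + axis i t)) (\<lambda>t. f (x + axis i t)) (nhds x)"
    using f \<rho> unfolding differentiable_along_def by (intro uniform_limit_along_axis) auto
qed (use \<rho> in auto)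

text \<open>The difference quotient on the line through \<open>x\<close> is nonzero at 0, hence
  bounded away from 0 for small \<open>t\<close>. Uniform convergence transfers this to nearby base
  points, with one radius for all of them.\<close>

lemma injective_along_axis:
  assumes f: "differentiable_along i f U" and U: "open U" "x \<in> U"
    and D: "deriv (\<lambda>t. f (x + axis i t)) 0 \<noteq> 0"
  obtains r where "r > 0" "\<And>y t. y \<in> ball x r \<Longrightarrow> norm t < r \<Longrightarrow> t \<noteq> 0 \<Longrightarrow> f (y + axis i t) \<noteq> f y"
proof -
  from U obtain R where R: "R > 0" "ball x R \<subseteq> U" by (metis open_contains_ball)
  have fR: "differentiable_along i f (ball x R)"
    using f R(2) by (rule differentiable_along_subset)
  let ?q = "\<lambda>y. diff_quot (\<lambda>t. f (y + axis i t))"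
  have "(\<lambda>t. f (x + axis i t)) holomorphic_on ball 0 R"
    by (rule holomorphic_along_axis[OF fR]) (simp add: dist_norm norm_axis)
  then have "?q x holomorphic_on ball 0 R" by (rule holomorphic_diff_quot)
  then have cont: "continuous_on (ball 0 R) (?q x)" by (rule holomorphic_on_imp_continuous_on)
  then have "isCont (?q x) 0" using R by (simp add: continuous_on_eq_continuous_at)
  then have "(?q x \<longlongrightarrow> ?q x 0) (nhds 0)"
    by (simp add: isCont_def tendsto_at_iff_tendsto_nhds)
  moreover have "?q x 0 \<noteq> 0" using D by (simp add: diff_quot_def)
  ultimately have "\<forall>\<^sub>F t in nhds 0. ?q x t \<noteq> 0" by (rule tendsto_imp_eventually_ne)
  then obtain s where s: "s > 0" "\<And>t. dist t 0 < s \<Longrightarrow> ?q x t \<noteq> 0"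
    unfolding eventually_nhds_metric by blast
  define \<rho> where "\<rho> = min s R / 2"
  have \<rho>: "0 < \<rho>" "\<rho> < s" "\<rho> < R" using s R by (auto simp: \<rho>_def)
  have "compact (?q x ` cball 0 \<rho>)"
    using \<rho> by (intro compact_continuous_image continuous_on_subset[OF cont]) auto
  moreover have "0 \<notin> ?q x ` cball 0 \<rho>"
    using s(2) \<rho> by force
  ultimately obtain d where d: "d > 0" "\<And>z. z \<in> ?q x ` cball 0 \<rho> \<Longrightarrow> d \<le> dist 0 z"
    using separate_point_closed[of "?q x ` cball 0 \<rho>" 0] compact_imp_closed by blast
  have "\<forall>\<^sub>F y in nhds x. \<forall>t\<in>cball 0 \<rho>. dist (?q y t) (?q x t) < d"
    by (rule uniform_limitD[OF uniform_limit_diff_quot_along_axis[OF fR \<rho>(1,3)] d(1)])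
  then obtain r where r: "r > 0" "\<And>y t. dist y x < r \<Longrightarrow> (t::complex) \<in> cball 0 \<rho> \<Longrightarrow> dist (?q y t) (?q x t) < d"
    unfolding eventually_nhds_metric by blast
  show ?thesis
  proof (rule that[of "min r \<rho>"])
    fix y and t :: complex assume y: "y \<in> ball x (min r \<rho>)" and t: "norm t < min r \<rho>" "t \<noteq> 0"
    have "dist (?q y t) (?q x t) < d" using y t by (intro r) (auto simp: dist_commute)
    moreover have "d \<le> dist 0 (?q x t)" using t by (intro d) auto
    ultimately have "?q y t \<noteq> 0" by (auto simp: dist_commute)
    then show "f (y + axis i t) \<noteq> f y" using t by (auto simp: diff_quot_def)
  qed (use r \<rho> in auto)
qed

text \<open>Otherwise base points tending to \<open>x\<close> have zero-free lines. By Hurwitz the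
  limit function, which is nonconstant because of \<open>s\<close>, would also be zero-free,
  contradicting \<open>f x = 0\<close>.\<close>

lemma zeros_persist_along_axis:
  assumes f: "differentiable_along i f (ball x R)" and \<rho>: "0 < \<rho>" "\<rho> < R"
    and "f x = 0" and nz: "norm s < \<rho>" "f (x + axis i s) \<noteq> 0"
  obtains r where "r > 0" "\<And>y. y \<in> ball x r \<Longrightarrow> \<exists>t. norm t < \<rho> \<and> f (y + axis i t) = 0"
proof (rule ccontr)
  assume *: "\<not> thesis"
  have "\<exists>y. y \<in> ball x (1 / Suc n) \<and> (\<forall>t. norm t < \<rho> \<longrightarrow> f (y + axis i t) \<noteq> 0)" for n
    using * that[of "1 / Suc n"] by auto
  then obtain y0 where y0: "\<And>n. y0 n \<in> ball x (1 / Suc n)"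
    "\<And>n t. norm t < \<rho> \<Longrightarrow> f (y0 n + axis i t) \<noteq> 0" by metis
  have "norm (dist (y0 n) x) \<le> inverse (real (Suc n))" for n
    using y0(1)[of n] by (simp add: dist_commute inverse_eq_divide)
  then have "(\<lambda>n. dist (y0 n) x) \<longlonglongrightarrow> 0"
    by (intro Lim_null_comparison[OF always_eventually LIMSEQ_inverse_real_of_nat]) blast
  then have y0_lim: "y0 \<longlonglongrightarrow> x" by (subst tendsto_dist_iff)
  have "\<forall>\<^sub>F n in sequentially. (\<lambda>t. f (y0 n + axis i t)) holomorphic_on ball 0 \<rho>"
    using eventually_compose_filterlim[OF eventually_holomorphic_along_axis[OF f \<rho>(2)] y0_lim] .
  \<comment> \<open>Hurwitz's theorem is applied to a sequence all of whose members are holomorphic,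
    so initial terms are dropped.\<close>
  then obtain N where N: "\<And>n. (\<lambda>t. f (y0 (n + N) + axis i t)) holomorphic_on ball 0 \<rho>"
    unfolding eventually_sequentially by (metis le_add2)
  define y where "y n = y0 (n + N)" for n
  have y_lim: "y \<longlonglongrightarrow> x" unfolding y_def using y0_lim by (rule LIMSEQ_ignore_initial_segment)
  have lim: "uniform_limit (cball 0 \<rho>) (\<lambda>n t. f (y n + axis i t)) (\<lambda>t. f (x + axis i t)) sequentially"
    using filterlim_compose[OF uniform_limit_along_axis y_lim] f \<rho> unfolding differentiable_along_def by blast
  have "f (x + axis i 0) \<noteq> 0"
  proof (rule Hurwitz_no_zeros[of "ball 0 \<rho>" "\<lambda>n t. f (y n + axis i t)" "\<lambda>t. f (x + axis i t)"])
    show "(\<lambda>t. f (x + axis i t)) holomorphic_on ball 0 \<rho>"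
      using \<rho> by (intro holomorphic_along_axis[OF f]) (simp add: dist_norm norm_axis)
    show "uniform_limit K (\<lambda>n t. f (y n + axis i t)) (\<lambda>t. f (x + axis i t)) sequentially"
      if "K \<subseteq> ball 0 \<rho>" for K
      using that ball_subset_cball by (intro uniform_limit_on_subset[OF lim]) blast
    show "\<not> (\<lambda>t. f (x + axis i t)) constant_on ball 0 \<rho>"
    proof
      assume "(\<lambda>t. f (x + axis i t)) constant_on ball 0 \<rho>"
      then obtain c where c: "\<And>t. t \<in> ball 0 \<rho> \<Longrightarrow> f (x + axis i t) = c" unfolding constant_on_def by blast
      show False using c[of 0] c[of s] assms by simp
    qed
  qed (use N y0 \<rho> in \<open>auto simp: y_def\<close>)
  then show False using \<open>f x = 0\<close> by simp
qed

text \<open>If \<open>f\<close> had simple zeros arbitrarily close to its double zero \<open>x\<close>, the line through such a zero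
  in direction \<open>i\<close> would by Hurwitz contain a second zero of \<open>f\<close>, hence of \<open>h\<close>, nearby.\<close>

lemma multiple_zeros_along_axis:
  assumes f: "differentiable_along i f U" and h: "differentiable_along i h U" and U: "open U" "x \<in> U"
    and Dh: "deriv (\<lambda>t. h (x + axis i t)) 0 \<noteq> 0"
    and fx: "f x = 0" "deriv (\<lambda>t. f (x + axis i t)) 0 = 0"
    and fh: "\<And>y. y \<in> U \<Longrightarrow> f y = 0 \<Longrightarrow> h y = 0"
  obtains r where "r > 0" "\<And>y. y \<in> ball x r \<Longrightarrow> f y = 0 \<Longrightarrow> deriv (\<lambda>t. f (y + axis i t)) 0 = 0"
proof (rule ccontr)
  assume *: "\<not> thesis"
  obtain r1 where r1: "r1 > 0"
      "\<And>y t. y \<in> ball x r1 \<Longrightarrow> norm t < r1 \<Longrightarrow> t \<noteq> 0 \<Longrightarrow> h (y + axis i t) \<noteq> h y"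
    using injective_along_axis[OF h U Dh] by blast
  from U obtain R where R: "R > 0" "ball x R \<subseteq> U" by (metis open_contains_ball)
  have fR: "differentiable_along i f (ball x R)"
    using f R(2) by (rule differentiable_along_subset)
  define \<rho> where "\<rho> = min r1 R / 2"
  have \<rho>: "0 < \<rho>" "\<rho> < r1" "\<rho> < R" using r1 R by (auto simp: \<rho>_def)
  let ?q = "\<lambda>y. diff_quot (\<lambda>t. f (y + axis i t))"
  have "\<exists>y. y \<in> ball x (1 / Suc n) \<and> f y = 0 \<and> deriv (\<lambda>t. f (y + axis i t)) 0 \<noteq> 0" for n
    using * that[of "1 / Suc n"] by auto
  then obtain y0 where y0: "\<And>n. y0 n \<in> ball x (1 / Suc n)"
    "\<And>n. f (y0 n) = 0 \<and> deriv (\<lambda>t. f (y0 n + axis i t)) 0 \<noteq> 0" by metis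
  have "norm (dist (y0 n) x) \<le> inverse (real (Suc n))" for n
    using y0(1)[of n] by (simp add: dist_commute inverse_eq_divide)
  then have "(\<lambda>n. dist (y0 n) x) \<longlonglongrightarrow> 0"
    by (intro Lim_null_comparison[OF always_eventually LIMSEQ_inverse_real_of_nat]) blast
  then have y0_lim: "y0 \<longlonglongrightarrow> x" by (subst tendsto_dist_iff)
  have "\<forall>\<^sub>F n in sequentially. y0 n \<in> ball x (R - \<rho>) \<inter> ball x r1"
    using \<rho> r1 y0_lim by (intro topological_tendstoD) auto
  moreover have "\<forall>\<^sub>F n in sequentially. (\<lambda>t. f (y0 n + axis i t)) holomorphic_on ball 0 \<rho>"
    using eventually_compose_filterlim[OF eventually_holomorphic_along_axis[OF fR \<rho>(3)] y0_lim] .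
  ultimately have "\<forall>\<^sub>F n in sequentially. y0 n \<in> ball x (R - \<rho>) \<inter> ball x r1 \<and>
      (\<lambda>t. f (y0 n + axis i t)) holomorphic_on ball 0 \<rho>"
    by (rule eventually_conj)
  then obtain N where N: "\<And>n. y0 (n + N) \<in> ball x (R - \<rho>) \<inter> ball x r1"
      "\<And>n. (\<lambda>t. f (y0 (n + N) + axis i t)) holomorphic_on ball 0 \<rho>"
    unfolding eventually_sequentially by (metis le_add2)
  define y where "y n = y0 (n + N)" for n
  have y_lim: "y \<longlonglongrightarrow> x" unfolding y_def using y0_lim by (rule LIMSEQ_ignore_initial_segment)
  have hol_x: "(\<lambda>t. f (x + axis i t)) holomorphic_on ball 0 \<rho>"
    using \<rho> by (intro holomorphic_along_axis[OF fR]) (simp add: dist_norm norm_axis)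
  \<comment> \<open>A second zero of \<open>f\<close> on this line would be a second zero of
    \<open>h\<close>, against the choice of \<open>r1\<close>; the radius \<open>R - \<rho>\<close>
    keeps the point inside \<open>U\<close>.\<close>
  have nz: "f (z + axis i t) \<noteq> 0"
    if z: "z \<in> ball x (R - \<rho>)" "z \<in> ball x r1" "f z = 0" and t: "t \<in> ball 0 \<rho>" "t \<noteq> 0" for z t
  proof
    have "norm (z + axis i t - x) \<le> norm (z - x) + norm (axis i t)"
      by (metis add_diff_eq norm_triangle_ineq diff_add_eq)
    then have "z + axis i t \<in> ball x R" 
      using z t by (simp add: dist_norm norm_axis norm_minus_commute)
    moreover have "z \<in> ball x R" using z \<rho> by auto
    moreover assume "f (z + axis i t) = 0"
    ultimately have "h (z + axis i t) = 0" "h z = 0" using fh R z by blast+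
    then show False using r1(2)[of z t] z t \<rho> by auto
  qed
  have nzx: "?q x t \<noteq> 0" if "t \<in> ball 0 \<rho>" "t \<noteq> 0" for t
    using nz[of x t] that fx(1) \<rho> R r1 by (auto simp: diff_quot_def)
  have lim: "uniform_limit (cball 0 \<rho>) (\<lambda>n. ?q (y n)) (?q x) sequentially"
    by (rule filterlim_compose[OF uniform_limit_diff_quot_along_axis[OF fR \<rho>(1,3)] y_lim])
  \<comment> \<open>Hurwitz is applied to the quotients: dividing out the simple zero at
    \<open>t = 0\<close> leaves functions without zeros, whereas the limit has a zero there because
    \<open>x\<close> is a multiple zero.\<close>
  have "?q x 0 \<noteq> 0"
  proof (rule Hurwitz_no_zeros[of "ball 0 \<rho>" "\<lambda>n. ?q (y n)" "?q x"])
    show "?q x holomorphic_on ball 0 \<rho>" by (rule holomorphic_diff_quot[OF hol_x])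
    show "?q (y n) holomorphic_on ball 0 \<rho>" for n
      unfolding y_def by (rule holomorphic_diff_quot[OF N(2)])
    show "uniform_limit K (\<lambda>n. ?q (y n)) (?q x) sequentially" if "K \<subseteq> ball 0 \<rho>" for K
      using that ball_subset_cball by (intro uniform_limit_on_subset[OF lim]) blast
    show "\<not> ?q x constant_on ball 0 \<rho>"
    proof
      assume "?q x constant_on ball 0 \<rho>"
      then obtain c where c: "\<And>t. t \<in> ball 0 \<rho> \<Longrightarrow> ?q x t = c" unfolding constant_on_def by blast
      have "c = 0" using c[of 0] \<rho> fx by (simp add: diff_quot_def)
      then show False using c[of "of_real (\<rho> / 2)"] nzx[of "of_real (\<rho> / 2)"] \<rho> by simp
    qed
    show "?q (y n) t \<noteq> 0" if t: "t \<in> ball 0 \<rho>" for n t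
    proof (cases "t = 0")
      case True
      then show ?thesis using y0(2) by (simp add: y_def diff_quot_def)
    next
      case False
      then show ?thesis using nz[of "y n" t] t N(1)[of n] y0(2) by (simp add: y_def diff_quot_def)
    qed
  qed (use \<rho> in auto)
  then show False using fx by (simp add: diff_quot_def)
qed

subsection \<open>Smoothness\<close>

definition complex_diff :: "(complex ^ 'n::finite \<Rightarrow> complex) \<Rightarrow> (complex ^ 'n \<Rightarrow> complex) \<Rightarrow> complex ^ 'n \<Rightarrow> bool" where
  "complex_diff f D x \<longleftrightarrow> (f has_derivative D) (at x) \<and> (\<forall>a v. D (a *s v) = a * D v)"

lemma complex_diff_const: "complex_diff (\<lambda>_. c) (\<lambda>_. 0) x"
  by (simp add: complex_diff_def)

lemma complex_diff_nth: "complex_diff (\<lambda>x. x $ i) (\<lambda>v. v $ i) x"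
  by (simp add: complex_diff_def bounded_linear_imp_has_derivative bounded_linear_vec_nth)

lemma complex_diff_add:
  "complex_diff f D x \<Longrightarrow> complex_diff g E x \<Longrightarrow> complex_diff (\<lambda>x. f x + g x) (\<lambda>v. D v + E v) x"
  by (auto simp: complex_diff_def distrib_left intro: has_derivative_add)

lemma complex_diff_mult:
  "complex_diff f D x \<Longrightarrow> complex_diff g E x \<Longrightarrow>
    complex_diff (\<lambda>x. f x * g x) (\<lambda>v. f x * E v + D v * g x) x"
  by (auto simp: complex_diff_def algebra_simps intro!: derivative_eq_intros)

lemma complex_diff_sum:
  "(\<And>a. a \<in> A \<Longrightarrow> \<exists>D. complex_diff (f a) D x) \<Longrightarrow> \<exists>D. complex_diff (\<lambda>x. \<Sum>a\<in>A. f a x) D x"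
proof (induction A rule: infinite_finite_induct)
  case (insert a A)
  then obtain D E where "complex_diff (f a) D x" "complex_diff (\<lambda>x. \<Sum>a\<in>A. f a x) E x" by blast
  from complex_diff_add[OF this] show ?case using insert by auto
qed (auto intro: complex_diff_const)

lemma complex_diff_prod:
  "(\<And>a. a \<in> A \<Longrightarrow> \<exists>D. complex_diff (f a) D x) \<Longrightarrow> \<exists>D. complex_diff (\<lambda>x. \<Prod>a\<in>A. f a x) D x"
proof (induction A rule: infinite_finite_induct)
  case (insert a A)
  then obtain D E where "complex_diff (f a) D x" "complex_diff (\<lambda>x. \<Prod>a\<in>A. f a x) E x" by blast
  from complex_diff_mult[OF this] show ?case using insert by auto
qed (auto intro: complex_diff_const)

lemma complex_diff_power:
  "complex_diff f D x \<Longrightarrow> \<exists>D. complex_diff (\<lambda>x. f x ^ k) D x"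
  by (induction k) (auto intro: complex_diff_const complex_diff_mult)

lemma complex_diff_meval: "\<exists>D. complex_diff (meval f) D x"
proof -
  have "\<exists>D. complex_diff (\<lambda>x. \<Prod>i\<in>UNIV. x $ i ^ Poly_Mapping.lookup m i) D x" for m
    by (intro complex_diff_prod complex_diff_power[OF complex_diff_nth])
  then have "\<exists>D. complex_diff (\<lambda>x. a * (\<Prod>i\<in>UNIV. x $ i ^ Poly_Mapping.lookup m i)) D x" for m a
    using complex_diff_mult[OF complex_diff_const] by blast
  then show ?thesis unfolding meval_def[abs_def] by (intro complex_diff_sum)
qed

lemma axis_eq_scale: "axis i t = t *s (axis i 1 :: complex ^ 'n::finite)"
  by (simp add: vec_eq_iff axis_def)

lemma bounded_linear_axis: "bounded_linear (axis i :: complex \<Rightarrow> complex ^ 'n::finite)"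
proof (rule bounded_linear_intro[of _ 1])
  show "axis i (r *\<^sub>R x) = r *\<^sub>R (axis i x :: complex ^ 'n)" for r x
    by (simp add: vec_eq_iff axis_def)
qed (simp_all add: axis_add norm_axis)

text \<open>Complex homogeneity of \<open>D\<close> turns the real derivative along the axis into
  multiplication by one complex number.\<close>

lemma complex_diff_along_axis:
  assumes "complex_diff f D y"
  shows "((\<lambda>t. f (y + axis i t)) has_field_derivative D (axis i 1)) (at 0)"
proof -
  have f: "(f has_derivative D) (at (y + axis i 0))" and hom: "\<And>a v. D (a *s v) = a * D v"
    using assms by (simp_all add: complex_diff_def)
  have "((\<lambda>t. y + axis i t) has_derivative axis i) (at 0)"
    using bounded_linear_imp_has_derivative[OF bounded_linear_axis]
    by (auto intro!: derivative_eq_intros)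
  then have "((\<lambda>t. f (y + axis i t)) has_derivative (\<lambda>t. D (axis i t))) (at 0)"
    by (rule has_derivative_compose) (rule f)
  moreover have "(\<lambda>t. D (axis i t)) = (*) (D (axis i 1))"
    by (rule ext) (metis axis_eq_scale hom mult.commute)
  ultimately show ?thesis by (simp add: has_field_derivative_def)
qed

lemma continuous_on_complex_diff: "(\<And>y. y \<in> U \<Longrightarrow> \<exists>D. complex_diff f D y) \<Longrightarrow> continuous_on U f"
  unfolding complex_diff_def
  by (metis continuous_at_imp_continuous_on has_derivative_continuous)

lemma differentiable_along_complex_diff:
  assumes "\<And>y. y \<in> U \<Longrightarrow> \<exists>D. complex_diff f D y"
  shows "differentiable_along i f U"
  unfolding differentiable_along_def field_differentiable_def
  using assms complex_diff_along_axis continuous_on_complex_diff by metis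

lemma differentiable_along_meval: "differentiable_along i (meval f) U"
  by (intro differentiable_along_complex_diff complex_diff_meval)

lemma continuous_on_meval: "continuous_on U (meval f)"
  by (intro continuous_on_complex_diff complex_diff_meval)

section \<open>Formal partial derivatives as derivatives along the axes\<close>

lemma meval_mpartial_axis:
  "((\<lambda>t. meval f (x + axis i t)) has_field_derivative meval (mpartial i f) x) (at 0)"
proof -
  have "(\<lambda>t. meval f (\<chi> j. if j = i then t + x $ i else x $ j)) = (\<lambda>t. meval f (x + axis i t))"
    by (intro ext arg_cong[where f = "meval f"]) (simp add: vec_eq_iff axis_def)
  then show ?thesis
    using meval_mpartial[of f i x] DERIV_shift[of "\<lambda>z. meval f (\<chi> j. if j = i then z else x $ j)" _ 0 "x $ i"]
    by simp
qed

lemma deriv_meval_axis: "deriv (\<lambda>t. meval f (x + axis i t)) 0 = meval (mpartial i f) x"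
  by (rule DERIV_imp_deriv) (rule meval_mpartial_axis)

text \<open>A polynomial is determined by its values, so the product rule for formal derivatives
  follows from the analytic one.\<close>

lemma mpartial_mult:
  fixes f g :: "'n::finite cpoly"
  shows "mpartial i (f * g) = mpartial i f * g + f * mpartial i g"
proof (rule cpoly_eqI)
  fix x
  have "((\<lambda>t. meval (f * g) (x + axis i t)) has_field_derivative
      meval (mpartial i f * g + f * mpartial i g) x) (at 0)"
    using DERIV_mult[OF meval_mpartial_axis[of f x i] meval_mpartial_axis[of g x i]]
    by (simp add: add_ac mult_ac)
  then show "meval (mpartial i (f * g)) x = meval (mpartial i f * g + f * mpartial i g) x"
    using meval_mpartial_axis DERIV_unique by blast
qed

lemma mpartial_Const [simp]: "mpartial i (Const a :: 'n::finite cpoly) = 0"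
proof (rule cpoly_eqI)
  fix x
  have "((\<lambda>t. meval (Const a) (x + axis i t)) has_field_derivative 0) (at 0)" by simp
  then show "meval (mpartial i (Const a)) x = meval 0 x"
    using meval_mpartial_axis DERIV_unique by fastforce
qed

text \<open>A nonconstant polynomial is nonconstant on some line through the origin, where the
  fundamental theorem of algebra yields a zero.\<close>

lemma meval_zero_exists:
  fixes f :: "'n::finite cpoly"
  assumes "f \<noteq> 0" "\<not> f dvd 1"
  obtains x where "meval f x = 0"
proof -
  obtain a where a: "meval f a \<noteq> meval f 0"
  proof (rule ccontr)
    assume *: "\<not> thesis"
    then have "meval f a = meval f 0" for a using that by blast
    then have "f = Const (meval f 0)" by (intro cpoly_eqI) simp
    then show False using assms Const_dvd_1 by (metis Const_0)
  qed
  obtain p where p: "\<And>t. poly p t = meval f (0 + t *s a)" using meval_line_poly by blast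
  \<comment> \<open>The values of \<open>p\<close> at 0 and 1 are \<open>meval f 0\<close> and
    \<open>meval f a\<close>, so \<open>p\<close> is not constant.\<close>
  have "\<nexists>c l. c \<noteq> 0 \<and> l = 0 \<and> p = pCons c l"
    using a p[of 0] p[of 1] by auto
  then obtain t where "poly p t = 0" using fundamental_theorem_of_algebra_alt by blast
  then show ?thesis using that p by metis
qed

lemma is_radE:
  fixes f r :: "'n::finite cpoly"
  assumes "is_rad f r"
  obtains g where "f = r * g" "r \<noteq> 0" "vanishing_set f = vanishing_set r"
    "squarefree f \<longrightarrow> (\<exists>a. a \<noteq> 0 \<and> f = Const a * r)"
proof -
  from assms obtain Q m a where Q: "finite Q" "\<forall>q\<in>Q. irreducible q \<and> m q > (0::nat)"
    and a: "a \<noteq> 0" and f: "f = Const a * (\<Prod>q\<in>Q. q ^ m q)" and r: "r = \<Prod>Q"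
    unfolding is_rad_def by (elim exE conjE)
  have "q ^ m q = q * q ^ (m q - 1)" if "q \<in> Q" for q
    using Q(2) that by (metis power_eq_if less_numeral_extra(3))
  then have "f = r * (Const a * (\<Prod>q\<in>Q. q ^ (m q - 1)))"
    by (simp add: f r prod.distrib[symmetric] mult.left_commute)
  moreover have "\<Prod>Q \<noteq> 0"
    using Q by (induction Q rule: finite_induct) auto
  moreover have "vanishing_set f = vanishing_set r"
    using Q a by (auto simp: vanishing_set_def f r)
  moreover have "\<exists>a. a \<noteq> 0 \<and> f = Const a * r" if sq: "squarefree f"
  proof -
    have "m q = 1" if q: "q \<in> Q" for q
    proof (rule ccontr)
      assume "m q \<noteq> 1"
      with Q q have "2 \<le> m q" by force
      then have "q ^ 2 dvd q ^ m q" by (rule le_imp_power_dvd)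
      also have "\<dots> dvd (\<Prod>q\<in>Q. q ^ m q)" using Q q by (intro dvd_prodI) auto
      finally have "q ^ 2 dvd f" unfolding f by (rule dvd_mult)
      with sq have "q dvd 1" by (rule squarefreeD)
      then show False using Q q by (auto simp: irreducible_def)
    qed
    then have "(\<Prod>q\<in>Q. q ^ m q) = \<Prod>Q" by (intro prod.cong) auto
    then show ?thesis using a f r by auto
  qed
  ultimately show ?thesis using that r by blast
qed

text \<open>By the product rule a singular zero of a factor is a singular zero of the
  product.\<close>

lemma smooth_as_scheme_factor:
  assumes "f = g * h" "smooth_as_scheme f"
  shows "smooth_as_scheme g"
  unfolding smooth_as_scheme_def
proof (rule notI, elim exE conjE)
  fix x assume "meval g x = 0" "\<forall>i. meval (mpartial i g) x = 0"
  then have "meval f x = 0 \<and> (\<forall>i. meval (mpartial i f) x = 0)" by (simp add: assms(1) mpartial_mult)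
  then show False using assms(2) unfolding smooth_as_scheme_def by blast
qed

lemma smooth_as_scheme_Const_mult:
  "a \<noteq> 0 \<Longrightarrow> smooth_as_scheme (Const a * f) \<longleftrightarrow> smooth_as_scheme f"
  by (simp add: smooth_as_scheme_def mpartial_mult)

text \<open>A repeated non-unit factor \<open>q\<close> has a zero, and there the product rule makes
  \<open>f\<close> and all its partial derivatives vanish.\<close>

lemma smooth_as_scheme_imp_squarefree:
  assumes "f \<noteq> 0" "smooth_as_scheme f"
  shows "squarefree f"
proof (rule squarefreeI, rule ccontr)
  fix q assume "q\<^sup>2 dvd f" and q: "\<not> q dvd 1"
  then obtain g where f: "f = q * (q * g)" by (auto simp: power2_eq_square mult.assoc elim!: dvdE)
  then have "q \<noteq> 0" using assms by auto
  with q obtain x where "meval q x = 0" using meval_zero_exists by blast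
  then have "meval f x = 0 \<and> (\<forall>i. meval (mpartial i f) x = 0)" by (simp add: f mpartial_mult)
  then show False using assms unfolding smooth_as_scheme_def by blast
qed

section \<open>Submanifolds and their local equations\<close>

lemma homeomorphism_derivative_inverse:
  fixes \<phi> :: "complex ^ 'n::finite \<Rightarrow> complex ^ 'n"
  assumes "homeomorphism U V \<phi> \<psi>" "open V" "x \<in> U"
    and D: "(\<phi> has_derivative D) (at x)" and E: "(\<psi> has_derivative E) (at (\<phi> x))"
  shows "D (E v) = v"
proof -
  have x: "\<psi> (\<phi> x) = x" "\<phi> x \<in> V" and inv: "\<And>z. z \<in> V \<Longrightarrow> \<phi> (\<psi> z) = z"
    using assms by (auto simp: homeomorphism_def)
  have "((\<lambda>z. \<phi> (\<psi> z)) has_derivative (\<lambda>v. D (E v))) (at (\<phi> x))"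
    by (rule has_derivative_compose[OF E]) (simp add: x D)
  then have "((\<lambda>z. z) has_derivative (\<lambda>v. D (E v))) (at (\<phi> x))"
    by (rule has_derivative_transform_within_open[OF _ \<open>open V\<close> x(2)]) (simp add: inv)
  then have "(\<lambda>v. D (E v)) = (\<lambda>v. v)"
    using has_derivative_ident has_derivative_unique by blast
  then show ?thesis by meson
qed

lemma complex_linear_eq_0:
  fixes D :: "complex ^ 'n::finite \<Rightarrow> complex"
  assumes "linear D" "\<And>a v. D (a *s v) = a * D v" "\<And>i. D (axis i 1) = 0"
  shows "D v = 0"
proof -
  have "D v = D (\<Sum>i\<in>UNIV. v $ i *s axis i 1)" by (simp add: basis_expansion)
  also have "\<dots> = 0" using assms by (simp add: linear_sum)
  finally show ?thesis .
qed

text \<open>The function \<open>h\<close> is a chart component with index outside \<open>I\<close>.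
  Assumption \<open>int\<close> guarantees such an index, and invertibility of the chart's
  derivative gives an axis along which \<open>h\<close> varies to first order.\<close>

lemma submanifold_local_equation:
  fixes S :: "(complex ^ 'n::finite) set"
  assumes "complex_submanifold d S" "x \<in> S" and int: "\<And>U. open U \<Longrightarrow> x \<in> U \<Longrightarrow> \<not> U \<subseteq> S"
  obtains U i h where "open U" "x \<in> U" "differentiable_along i h U"
    "deriv (\<lambda>t. h (x + axis i t)) 0 \<noteq> 0" "\<And>y. y \<in> U \<Longrightarrow> y \<in> S \<Longrightarrow> h y = 0"
proof -
  obtain U V I and \<phi> \<psi> :: "complex ^ 'n \<Rightarrow> complex ^ 'n" where chart: "open U \<and> x \<in> U \<and> open V \<and> homeomorphism U V \<phi> \<psi> \<and>
     holomorphic_map_on \<phi> U \<and> holomorphic_map_on \<psi> V \<and>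
     card I = d \<and> \<phi> ` (S \<inter> U) = {z \<in> V. \<forall>i. i \<notin> I \<longrightarrow> z $ i = 0}"
    using bspec[OF assms(1)[unfolded complex_submanifold_def] assms(2)] by (elim exE)
  then have U: "open U" "x \<in> U" "open V" "homeomorphism U V \<phi> \<psi>"
    and hol: "holomorphic_map_on \<phi> U" "holomorphic_map_on \<psi> V"
    and flat: "\<phi> ` (S \<inter> U) = {z \<in> V. \<forall>i. i \<notin> I \<longrightarrow> z $ i = 0}"
    by blast+
  have "\<exists>k. k \<notin> I"
  proof (rule ccontr)
    assume "\<nexists>k. k \<notin> I"
    then have "\<phi> ` (S \<inter> U) = V" using flat by auto
    have "U \<subseteq> S"
    proof
      fix u assume u: "u \<in> U"
      then have "\<phi> u \<in> \<phi> ` (S \<inter> U)" using U(4) \<open>\<phi> ` (S \<inter> U) = V\<close> by (auto simp: homeomorphism_def)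
      then obtain s where "s \<in> S" "s \<in> U" "\<phi> u = \<phi> s" by auto
      then show "u \<in> S" using U(4) u unfolding homeomorphism_def by metis
    qed
    then show False using int U by blast
  qed
  then obtain k where k: "k \<notin> I" by blast
  have comp: "\<exists>D. complex_diff (\<lambda>z. \<phi> z $ k) D y" if "y \<in> U" for y
  proof -
    from hol(1) that obtain D where "(\<phi> has_derivative D) (at y)" "\<And>a v. D (a *s v) = a *s D v"
      unfolding holomorphic_map_on_def by blast
    then have "complex_diff (\<lambda>z. \<phi> z $ k) (\<lambda>v. D v $ k) y"
      unfolding complex_diff_def by (auto intro: bounded_linear.has_derivative[OF bounded_linear_vec_nth])
    then show ?thesis by blast
  qed
  obtain D where D: "(\<phi> has_derivative D) (at x)" "\<And>a v. D (a *s v) = a *s D v"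
    using hol(1) U(2) unfolding holomorphic_map_on_def by blast
  have "\<phi> x \<in> V" using U by (auto simp: homeomorphism_def)
  then obtain E where E: "(\<psi> has_derivative E) (at (\<phi> x))"
    using hol(2) unfolding holomorphic_map_on_def by blast
  have Dk: "complex_diff (\<lambda>z. \<phi> z $ k) (\<lambda>v. D v $ k) x"
    using D unfolding complex_diff_def
    by (auto intro: bounded_linear.has_derivative[OF bounded_linear_vec_nth])
  \<comment> \<open>If \<open>D\<close> had zero \<open>k\<close>-th component on all axes, it would
    have none at all, against \<open>D (E v) = v\<close> for \<open>v = axis k 1\<close>.\<close>
  obtain i where i: "D (axis i 1) $ k \<noteq> 0"
  proof (rule ccontr)
    assume "\<not> thesis"
    then have 0: "D (axis i 1) $ k = 0" for i using that by blast
    have "linear (\<lambda>v. D v $ k)"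
      using Dk unfolding complex_diff_def by (metis has_derivative_linear)
    then have "D (E (axis k 1)) $ k = 0"
      by (rule complex_linear_eq_0[where D = "\<lambda>v. D v $ k"]) (simp_all add: D(2) 0)
    then show False
      using homeomorphism_derivative_inverse[OF U(4,3,2) D(1) E, of "axis k 1"] by (simp add: axis_def)
  qed
  show ?thesis
  proof (rule that[OF U(1,2)])
    show "differentiable_along i (\<lambda>z. \<phi> z $ k) U"
      by (rule differentiable_along_complex_diff) (rule comp)
    show "deriv (\<lambda>t. \<phi> (x + axis i t) $ k) 0 \<noteq> 0"
      using DERIV_imp_deriv[OF complex_diff_along_axis[OF Dk, of i]] i by simp
    show "\<phi> y $ k = 0" if "y \<in> U" "y \<in> S" for y
    proof -
      have "\<phi> y \<in> \<phi> ` (S \<inter> U)" using that by blast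
      then show ?thesis using flat k by auto
    qed
  qed
qed

lemma meval_axis_poly:
  obtains p where "\<And>t. poly p t = meval f (x + axis i t)"
    "\<And>t. poly (pderiv p) t = meval (mpartial i f) (x + axis i t)"
proof -
  obtain p where "\<And>t. poly p t = meval f (x + t *s axis i 1)"
    using meval_line_poly by blast
  then have p: "\<And>t. poly p t = meval f (x + axis i t)"
    by (simp flip: axis_eq_scale)
  have "poly (pderiv p) t = meval (mpartial i f) (x + axis i t)" for t
  proof -
    have "((\<lambda>s. poly p (s + t)) has_field_derivative meval (mpartial i f) (x + axis i t)) (at 0)"
      using meval_mpartial_axis[of f "x + axis i t" i] by (simp add: p axis_add add_ac)
    then have "(poly p has_field_derivative meval (mpartial i f) (x + axis i t)) (at t)"
      using DERIV_shift[of "poly p" _ 0 t] by simp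
    then show ?thesis using poly_DERIV DERIV_unique by blast
  qed
  then show ?thesis using that p by blast
qed

text \<open>On the line through \<open>x\<close> in direction \<open>i\<close>, \<open>q\<close>
  restricts to a nonconstant univariate polynomial, which cannot divide its own derivative for
  degree reasons.\<close>

lemma not_dvd_mpartial:
  assumes "meval q x = 0" "meval q (x + axis i s) \<noteq> 0"
  shows "\<not> q dvd mpartial i q"
proof
  assume "q dvd mpartial i q"
  then obtain g where g: "mpartial i q = q * g" by (elim dvdE)
  obtain p where p: "\<And>t. poly p t = meval q (x + axis i t)"
    "\<And>t. poly (pderiv p) t = meval (mpartial i q) (x + axis i t)"
    using meval_axis_poly by blast
  obtain u where u: "\<And>t. poly u t = meval g (x + axis i t)"
    using meval_axis_poly by blast
  have "poly (pderiv p) = poly (p * u)" by (rule ext) (simp add: p u g)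
  then have dvd: "p dvd pderiv p" by (metis poly_eq_poly_eq_iff dvd_triv_left)
  have "pderiv p = 0"
  proof (rule ccontr)
    assume "pderiv p \<noteq> 0"
    with dvd have "degree p \<le> degree (pderiv p)" by (rule dvd_imp_degree_le)
    then have "degree p = 0" by (simp add: degree_pderiv)
    then show False using \<open>pderiv p \<noteq> 0\<close> by (simp add: pderiv_eq_0_iff)
  qed
  then have "degree p = 0" by (simp add: pderiv_eq_0_iff)
  then obtain c where "p = [:c:]" by (rule degree_eq_zeroE)
  then show False using p(1)[of 0] p(1)[of s] assms by simp
qed

lemma irreducible_dvd_prod:
  fixes q :: "'n::finite cpoly"
  assumes "finite P" "irreducible q" "q dvd \<Prod>P"
  obtains p where "p \<in> P" "q dvd p"
proof -
  have "\<exists>p\<in>P. q dvd p"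
    using assms(1,3)
  proof (induction P rule: finite_induct)
    case empty
    then show ?case using assms(2) by (auto simp: irreducible_def)
  next
    case (insert p P)
    then show ?case using irreducible_imp_prime_cpoly[OF assms(2), of p "\<Prod>P"] by auto
  qed
  then show ?thesis using that by blast
qed

lemma submanifold_imp_smooth_rad:
  fixes f r :: "'n::finite cpoly"
  assumes rad: "is_rad f r" and S: "complex_submanifold d (vanishing_set r)"
  shows "smooth_as_scheme r"
  unfolding smooth_as_scheme_def
proof (rule notI, elim exE conjE)
  fix x assume x: "meval r x = 0" and grad: "\<forall>i. meval (mpartial i r) x = 0"
  from rad obtain Q m a where Q: "finite Q" "\<forall>q\<in>Q. irreducible q \<and> m q > (0::nat)"
    and dist: "\<forall>q\<in>Q. \<forall>q'\<in>Q. \<forall>b. q' = Const b * q \<longrightarrow> q' = q" and r: "r = \<Prod>Q"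
    unfolding is_rad_def by (elim exE conjE)
  have r0: "r \<noteq> 0" using rad by (elim is_radE)
  have int: "\<not> U \<subseteq> vanishing_set r" if "open U" "x \<in> U" for U
    using meval_open_eq_0[OF that, of r] r0 by (auto simp: vanishing_set_def)
  have xS: "x \<in> vanishing_set r" using x by (simp add: vanishing_set_def)
  have "\<exists>U i h. open U \<and> x \<in> U \<and> differentiable_along i h U \<and>
    deriv (\<lambda>t. h (x + axis i t)) 0 \<noteq> 0 \<and> (\<forall>y\<in>U. meval r y = 0 \<longrightarrow> h y = 0)"
  proof (rule submanifold_local_equation[OF S xS])
    fix U i h assume "open U" "x \<in> U" "differentiable_along i h U"
      "deriv (\<lambda>t. h (x + axis i t)) 0 \<noteq> 0" "\<And>y. y \<in> U \<Longrightarrow> y \<in> vanishing_set r \<Longrightarrow> h y = 0"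
    then show ?thesis unfolding vanishing_set_def by blast
  qed (rule int)
  then obtain U i h where U: "open U" "x \<in> U" and h: "differentiable_along i h U"
    "deriv (\<lambda>t. h (x + axis i t)) 0 \<noteq> 0" and rh: "\<forall>y\<in>U. meval r y = 0 \<longrightarrow> h y = 0"
    by (elim exE conjE)
  obtain r1 where r1: "r1 > 0" "\<And>y. y \<in> ball x r1 \<Longrightarrow> meval r y = 0 \<Longrightarrow> meval (mpartial i r) y = 0"
    by (rule multiple_zeros_along_axis[OF differentiable_along_meval h(1) U h(2) x,
          unfolded deriv_meval_axis, OF spec[OF grad] rh[rule_format]]) (assumption, assumption, rule that, assumption, blast)
  obtain r2 where r2: "r2 > 0" "\<And>y t. y \<in> ball x r2 \<Longrightarrow> norm t < r2 \<Longrightarrow> t \<noteq> 0 \<Longrightarrow> h (y + axis i t) \<noteq> h y"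
    by (rule injective_along_axis[OF h(1) U h(2)]) (rule that, assumption, blast)
  obtain r3 where r3: "r3 > 0" "ball x r3 \<subseteq> U" using U by (metis open_contains_ball)
  \<comment> \<open>A nonzero step short enough for \<open>h\<close> to be injective along the axis,
    so that \<open>r\<close> is nonzero at \<open>x + axis i s\<close>. It stays below
    \<open>r1 / 2\<close>, the radius used for the persistence of zeros of \<open>q\<close>.\<close>
  define s :: complex where "s = of_real (min (r1 / 2) (min r2 r3) / 2)"
  have s: "norm s < r1 / 2" "norm s < r2" "norm s < r3" "s \<noteq> 0"
    using r1 r2 r3 by (auto simp: s_def)
  have "x + axis i s \<in> U" using r3 s by (auto simp: dist_norm norm_axis)
  then have rs: "meval r (x + axis i s) \<noteq> 0"
    using r2(2)[of x s] s r2(1) rh U x by auto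
  obtain q where q: "q \<in> Q" "meval q x = 0"
    using x Q(1) by (auto simp: r)
  have irr: "irreducible q" using Q q by blast
  have rq: "r = q * \<Prod>(Q - {q})" using Q(1) q(1) by (simp add: r prod.remove)
  then have qs: "meval q (x + axis i s) \<noteq> 0" using rs by auto
  have deg: "degree (up i q) > 0"
  proof (rule ccontr)
    assume "\<not> ?thesis"
    then have "q \<in> polys_in (UNIV - {i})" by (simp add: polys_in_iff)
    then have "meval q (x + axis i s) = meval q x"
      by (rule meval_polys_in) (auto simp: axis_def)
    then show False using q qs by simp
  qed
  \<comment> \<open>In the product rule one term is a multiple of \<open>q\<close>. By primality
    \<open>q\<close> would have to divide its own derivative or another element of \<open>Q\<close>,
    which would then be a constant multiple of \<open>q\<close>.\<close>
  have ndvd: "\<not> q dvd mpartial i r"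
  proof
    assume "q dvd mpartial i r"
    then have "q dvd mpartial i q * \<Prod>(Q - {q})"
      unfolding rq mpartial_mult by (metis dvd_add_left_iff dvd_triv_left)
    then have dvd: "q dvd \<Prod>(Q - {q})"
      using irreducible_imp_prime_cpoly[OF irr] not_dvd_mpartial[OF q(2) qs] by blast
    have "finite (Q - {q})" using Q(1) by simp
    then obtain q' where q': "q' \<in> Q - {q}" "q dvd q'"
      using dvd by (rule irreducible_dvd_prod[OF _ irr])
    then obtain u where u: "q' = q * u" by (elim dvdE)
    have "irreducible q'" using Q q' by blast
    then have "u dvd 1" using irr irreducibleD[OF _ u] by (auto simp: irreducible_def)
    then obtain b where "u = Const b" by (rule cpoly_unitE)
    then have "q' = Const b * q" using u by (simp add: mult.commute)
    then show False using dist q(1) q' by blast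
  qed
  have "insert i (UNIV - {i}) = UNIV" by auto
  then have "\<exists>c a b. c \<in> polys_in (UNIV - {i}) \<and> c \<noteq> 0 \<and> a \<in> UNIV \<and> b \<in> UNIV \<and> c = q * a + mpartial i r * b"
    using eliminate_variable[OF irreducibles_prime_all[of "UNIV - {i}"] _ _ irr deg _ ndvd] by simp
  then obtain c a b where c: "c \<in> polys_in (UNIV - {i})" "c \<noteq> 0" "c = q * a + mpartial i r * b"
    by (elim exE conjE)
  \<comment> \<open>One half of \<open>r1\<close> is for the displacement of \<open>y\<close>, the
    other for the parameter \<open>t\<close>, so that the zero found stays where
    \<open>mpartial i r\<close> vanishes along with \<open>r\<close>.\<close>
  have half: "0 < r1 / 2" "r1 / 2 < r1" using r1(1) by auto
  obtain r4 where r4: "r4 > 0" "\<And>y. y \<in> ball x r4 \<Longrightarrow> \<exists>t. norm t < r1 / 2 \<and> meval q (y + axis i t) = 0"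
    by (rule zeros_persist_along_axis[OF differentiable_along_meval half q(2) s(1) qs]) (rule that, assumption, blast)
  have "c = 0"
  proof (rule meval_open_eq_0[where x = x])
    fix y assume y: "y \<in> ball x (min r4 (r1 / 2))"
    then obtain t where t: "norm t < r1 / 2" "meval q (y + axis i t) = 0" using r4 by auto
    have "norm (y + axis i t - x) \<le> norm (y - x) + norm (axis i t)"
      by (metis add_diff_eq norm_triangle_ineq diff_add_eq)
    then have "y + axis i t \<in> ball x r1"
      using y t by (simp add: dist_norm norm_axis norm_minus_commute)
    moreover have "meval r (y + axis i t) = 0" using t by (simp add: rq)
    ultimately have "meval c (y + axis i t) = 0" using r1(2) t by (simp add: c(3))
    moreover have "meval c y = meval c (y + axis i t)"
      by (rule meval_polys_in[OF c(1)]) (auto simp: axis_def)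
    ultimately show "meval c y = 0" by simp
  qed (use r1 r4 in auto)
  then show False using c(2) by blast
qed

text \<open>The chart takes \<open>r\<close> as a new coordinate in place of one along which its
  derivative is nonzero. Invariance of domain makes this injective map a homeomorphism onto an open
  set, and invertible derivatives make the inverse holomorphic.\<close>

lemma smooth_imp_submanifold:
  fixes r :: "'n::finite cpoly"
  assumes "smooth_as_scheme r"
  shows "complex_submanifold (CARD('n) - 1) (vanishing_set r)"
  unfolding complex_submanifold_def
proof
  fix x assume "x \<in> vanishing_set r"
  then obtain i where i: "meval (mpartial i r) x \<noteq> 0"
    using assms by (auto simp: smooth_as_scheme_def vanishing_set_def)
  obtain e where e: "e > 0" "\<And>y t. y \<in> ball x e \<Longrightarrow> norm t < e \<Longrightarrow> t \<noteq> 0 \<Longrightarrow> meval r (y + axis i t) \<noteq> meval r y"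
    using injective_along_axis[OF differentiable_along_meval open_UNIV UNIV_I, of r x i] i
    unfolding deriv_meval_axis by blast
  \<comment> \<open>Two points of the half-radius ball are less than \<open>e\<close> apart, as
    injectivity requires; the second condition keeps the derivative of the chart injective.\<close>
  define U where "U = ball x (e / 2) \<inter> {y. meval (mpartial i r) y \<noteq> 0}"
  have "open {y. meval (mpartial i r) y \<noteq> 0}"
    using continuous_on_meval by (intro open_Collect_neq) auto
  then have U: "open U" "x \<in> U" using e i by (auto simp: U_def)
  \<comment> \<open>replaces the \<open>i\<close>-th coordinate by \<open>r\<close>\<close>
  define \<phi> where "\<phi> y = y + axis i (meval r y - y $ i)" for y
  have nth: "\<phi> y $ j = (if j = i then meval r y else y $ j)" for y j
    by (simp add: \<phi>_def axis_def)
  have inj: "inj_on \<phi> U"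
  proof (rule inj_onI)
    fix y z assume y: "y \<in> U" and z: "z \<in> U" and eq: "\<phi> y = \<phi> z"
    define t where "t = z $ i - y $ i"
    have zt: "z = y + axis i t"
    proof (subst vec_eq_iff, rule allI)
      fix j show "z $ j = (y + axis i t) $ j"
        using arg_cong[OF eq, of "\<lambda>v. v $ j"] by (auto simp: nth axis_def t_def)
    qed
    have "norm t = dist z y" by (simp add: zt dist_norm norm_axis)
    also have "\<dots> < e" using y z dist_triangle_half_r[of x z e y] by (simp add: U_def dist_commute)
    finally have "norm t < e" .
    moreover have "meval r z = meval r y" using arg_cong[OF eq, of "\<lambda>v. v $ i"] by (simp add: nth)
    moreover have "y \<in> ball x e" using y e(1) by (simp add: U_def)
    ultimately have "t = 0" using e(2)[of y t] zt by blast
    then show "y = z" using zt by simp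
  qed
  have deriv: "\<exists>D. (\<phi> has_derivative D) (at y) \<and> (\<forall>a v. D (a *s v) = a *s D v) \<and>
      (meval (mpartial i r) y \<noteq> 0 \<longrightarrow> inj D)" for y
  proof -
    obtain E where E: "complex_diff (meval r) E y" using complex_diff_meval by blast
    define D where "D v = v + axis i (E v - v $ i)" for v
    have "((\<lambda>y. meval r y - y $ i) has_derivative (\<lambda>v. E v - v $ i)) (at y)"
      using E complex_diff_nth[of i y] unfolding complex_diff_def by (intro has_derivative_diff) auto
    then have der: "(\<phi> has_derivative D) (at y)"
      unfolding \<phi>_def[abs_def] D_def[abs_def]
      by (intro has_derivative_add has_derivative_ident bounded_linear.has_derivative[OF bounded_linear_axis])
    moreover have "D (a *s v) = a *s D v" for a v
      using E by (simp add: D_def complex_diff_def vec_eq_iff axis_def algebra_simps)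
    moreover have "inj D" if nz: "meval (mpartial i r) y \<noteq> 0"
    proof -
      \<comment> \<open>A kernel vector lies on axis \<open>i\<close>, where \<open>E\<close> is
        multiplication by the nonzero partial derivative.\<close>
      have "v = 0" if v: "D v = 0" for v
      proof -
        have vj: "v $ j = 0" if "j \<noteq> i" for j
          using arg_cong[OF v, of "\<lambda>v. v $ j"] that by (simp add: D_def axis_def)
        have "E v = 0"
          using arg_cong[OF v, of "\<lambda>v. v $ i"] by (simp add: D_def axis_def)
        moreover have "v = v $ i *s axis i 1" by (auto simp: vec_eq_iff axis_def vj)
        ultimately have "v $ i * E (axis i 1) = 0" using E unfolding complex_diff_def by metis
        moreover have "E (axis i 1) = meval (mpartial i r) y"
          using DERIV_unique[OF complex_diff_along_axis[OF E] meval_mpartial_axis] .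
        ultimately have "v $ i = 0" using nz by simp
        then show "v = 0" using vj by (metis vec_eq_iff zero_index)
      qed
      then show "inj D"
        using linear_injective_0[OF has_derivative_linear[OF der]] by blast
    qed
    ultimately show ?thesis by blast
  qed
  have cont: "continuous_on U \<phi>"
    using deriv by (metis continuous_at_imp_continuous_on has_derivative_continuous)
  obtain \<psi> where hom: "homeomorphism U (\<phi> ` U) \<phi> \<psi>"
    using invariance_of_domain_homeomorphism[OF U(1) cont _ inj] by auto
  have openV: "open (\<phi> ` U)" using invariance_of_domain[OF cont U(1) inj] .
  have "holomorphic_map_on \<phi> U"
    using deriv unfolding holomorphic_map_on_def by blast
  moreover have "holomorphic_map_on \<psi> (\<phi> ` U)"
    unfolding holomorphic_map_on_def
  proof
    fix z assume z: "z \<in> \<phi> ` U"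
    then have "\<psi> z \<in> U" using hom by (auto simp: homeomorphism_def)
    then have nz: "meval (mpartial i r) (\<psi> z) \<noteq> 0" by (simp add: U_def)
    then obtain D where D: "(\<phi> has_derivative D) (at (\<psi> z))" "\<And>a v. D (a *s v) = a *s D v" "inj D"
      using deriv by blast
    have lin: "linear D" using D(1) by (rule has_derivative_linear)
    obtain E where E: "linear E" "E \<circ> D = id"
      using linear_injective_left_inverse[OF lin D(3)] by blast
    have "(\<psi> has_derivative E) (at z)"
    proof (rule has_derivative_inverse_basic[where f = \<phi> and f' = D and T = "\<phi> ` U"])
      show "bounded_linear E" using E(1) by (simp add: linear_conv_bounded_linear)
      show "continuous (at z) \<psi>"
        using hom openV z by (auto simp: homeomorphism_def continuous_on_eq_continuous_at)
    qed (use hom openV z D(1) E(2) in \<open>auto simp: homeomorphism_def\<close>)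
    \<comment> \<open>Complex linearity passes from \<open>D\<close> to its inverse because every
      \<open>w\<close> is a value of \<open>D\<close>.\<close>
    moreover have "E (a *s w) = a *s E w" for a w
    proof -
      have "surj D" using lin D(3) by (rule linear_injective_imp_surjective) (rule refl)
      then obtain v where v: "w = D v" by (metis surjD)
      have "E (D u) = u" for u using E(2) by (metis comp_apply id_apply)
      then show ?thesis by (metis v D(2))
    qed
    ultimately show "\<exists>D. (\<psi> has_derivative D) (at z) \<and> (\<forall>a v. D (a *s v) = a *s D v)" by blast
  qed
  moreover have "card (UNIV - {i}) = CARD('n) - 1" by (simp add: card_Diff_singleton)
  moreover have "\<phi> ` (vanishing_set r \<inter> U) = {z \<in> \<phi> ` U. \<forall>j. j \<notin> UNIV - {i} \<longrightarrow> z $ j = 0}"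
    by (auto simp: vanishing_set_def nth)
  ultimately show "\<exists>U V (\<phi> :: complex ^ 'n \<Rightarrow> complex ^ 'n) \<psi> I.
     open U \<and> x \<in> U \<and> open V \<and> homeomorphism U V \<phi> \<psi> \<and>
     holomorphic_map_on \<phi> U \<and> holomorphic_map_on \<psi> V \<and>
     card I = CARD('n) - 1 \<and> \<phi> ` (vanishing_set r \<inter> U) = {z \<in> V. \<forall>i. i \<notin> I \<longrightarrow> z $ i = 0}"
    using U openV hom by blast
qed

section \<open>Application to the slowness polynomial\<close>

lemma slowness_poly_nonzero: "slowness_poly (c :: 'n::finite \<Rightarrow> _) \<noteq> 0"
proof -
  have "meval (slowness_poly c) 0 = det (- mat 1 :: complex ^ 'n ^ 'n)"
    unfolding meval_slowness_poly
    by (rule arg_cong[where f = det]) (simp add: vec_eq_iff christoffel_def)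
  also have "\<dots> = (\<Prod>i\<in>UNIV. (- mat 1 :: complex ^ 'n ^ 'n) $ i $ i)"
    by (rule det_diagonal) (simp add: mat_def)
  also have "\<dots> \<noteq> 0" by (simp add: mat_def)
  finally show ?thesis by auto
qed

theorem proposition9:
  fixes c :: "'n::finite \<Rightarrow> 'n \<Rightarrow> 'n \<Rightarrow> 'n \<Rightarrow> real"
  assumes "stiffness_tensor c" and "positive_definite_tensor c"
  shows "(smooth_as_scheme (slowness_poly c) \<longrightarrow> smooth_as_variety (slowness_poly c)) \<and>
    (squarefree (slowness_poly c) \<longrightarrow>
       (smooth_as_scheme (slowness_poly c) \<longleftrightarrow> smooth_as_variety (slowness_poly c))) \<and>
    (\<not> squarefree (slowness_poly c) \<longrightarrow> \<not> smooth_as_scheme (slowness_poly c)) \<and>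
    (smooth_as_complex_manifold (slowness_surface c) \<longleftrightarrow> smooth_as_variety (slowness_poly c))"
proof -
  let ?f = "slowness_poly c"
  have f0: "?f \<noteq> 0" by (rule slowness_poly_nonzero)
  then have rad: "is_rad ?f (rad ?f)" by (rule is_rad_rad)
  then obtain g where g: "?f = rad ?f * g" and van: "vanishing_set ?f = vanishing_set (rad ?f)"
    and sq: "squarefree ?f \<longrightarrow> (\<exists>a. a \<noteq> 0 \<and> ?f = Const a * rad ?f)"
    by (rule is_radE)
  have "smooth_as_scheme ?f \<longrightarrow> smooth_as_variety ?f"
    using smooth_as_scheme_factor[OF g] by (simp add: smooth_as_variety_def)
  moreover have "smooth_as_scheme ?f \<longleftrightarrow> smooth_as_variety ?f" if "squarefree ?f"
  proof -
    obtain a where "a \<noteq> 0" "?f = Const a * rad ?f" using sq \<open>squarefree ?f\<close> by blast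
    then show ?thesis unfolding smooth_as_variety_def by (metis smooth_as_scheme_Const_mult)
  qed
  moreover have "\<not> squarefree ?f \<longrightarrow> \<not> smooth_as_scheme ?f"
    using smooth_as_scheme_imp_squarefree[OF f0] by blast
  \<comment> \<open>The surface is also the zero set of the radical. One direction accepts any
    dimension \<open>d\<close>, the other supplies \<open>CARD('n) - 1\<close>.\<close>
  moreover have "smooth_as_complex_manifold (slowness_surface c) \<longleftrightarrow> smooth_as_variety ?f"
    unfolding smooth_as_complex_manifold_def slowness_surface_def smooth_as_variety_def van
    using submanifold_imp_smooth_rad[OF rad] smooth_imp_submanifold by blast
  ultimately show ?thesis by blast
qed

end
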